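(* Let $p:\Omega\to\Lambda$ be a connected covering of $k$-graphs, $x\in\Lambda^0$, and $v\in p^{-1}(x)$. Then the following are equivalent: (i) the subgroup $p_*\pi(\Omega,v)$ of $\pi(\Lambda,x)$ is normal; (ii) $\operatorname{Aut}(\Omega,p)$ acts transitively on $p^{-1}(x)$; (iii) the covering $\Omega/\operatorname{Aut}(\Omega,p)\to\Lambda$ induced by $p$ is an isomorphism; (iv) $(\Omega,p)$ is isomorphic to the quotient covering $\Omega\to\Omega/\operatorname{Aut}(\Omega,p)$, as coverings with common domain $\Omega$.
   Context: A $k$-graph is a small category $\Lambda$ with a functor $d:\Lambda\to\mathbb N^k$ (the degree) satisfying the factorization property: if $d(\alpha)=n+l$ with $n,l\in\mathbb N^k$, there are unique $\beta,\gamma\in\Lambda$ with $d(\beta)=n$, $d(\gamma)=l$, $\alpha=\beta\gamma$. $\Lambda^0$ is the set of objects (vertices, identified with identity morphisms); $s(\alpha)$ and $r(\alpha)$ are the domain and codomain of $\alpha$. $u\mathcal C=r^{-1}(u)$, $\mathcal C v=s^{-1}(v)$, $u\mathcal Cv=u\mathcal C\cap\mathcal Cv$. A small category $\mathcal C$ is connected if the equivalence relation on $\mathcal C^0$ generated by $\{(u,v)\mid u\mathcal Cv\neq\emptyset\}$ is all of $\mathcal C^0\times\mathcal C^0$. A $k$-graph morphism is a degree-preserving functor. A covering of $\Lambda$ is a surjective $k$-graph morphism $p:\Omega\to\Lambda$ such that for all $v\in\Omega^0$, $p$ maps $\Omega v$ bijectively onto $\Lambda p(v)$ and $v\Omega$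 bijectively onto $p(v)\Lambda$. It is connected if $\Omega$ (hence $\Lambda$) is connected. For $x\in\Lambda^0$, $p^{-1}(x)$ consists of vertices of $\Omega$. $\operatorname{Aut}(\Omega,p)$ is the group of $k$-graph automorphisms $\phi$ of $\Omega$ with $p\circ\phi=p$. The fundamental groupoid of $\Lambda$ is the groupoid $\mathcal G(\Lambda)$ with $\mathcal G(\Lambda)^0=\Lambda^0$, together with a functor $i:\Lambda\to\mathcal G(\Lambda)$ that is the identity on $\Lambda^0$, such that every functor from $\Lambda$ to a groupoid factors uniquely through $i$. The fundamental group at $x\in\Lambda^0$ is $\pi(\Lambda,x)=x\mathcal G(\Lambda)x$. A covering $p$ induces homomorphisms $p_*:\pi(\Omega,v)\to\pi(\Lambda,p(v))$. For a connected covering, $\operatorname{Aut}(\Omega,p)$ acts freely on $\Omega$, and the set $\Omega/\operatorname{Aut}(\Omega,p)$ of orbits $[\lambda]$ is a $k$-graph with $s[\lambda]=[s(\lambda)]$, $r[\lambda]=[r(\lambda)]$, $[\lambda][\mu]=[\lambda\mu]$ (representatives chosen so that $s(\lambda)=r(\mu)$) and $d[\lambda]=d(\lambda)$; the quotient map $\Omega\to\Omega/\operatorname{Aut}(\Omega,p)$ and the induced map $[\lambda]\mapsto p(\lambda)$ from $\Omega/\operatorname{Aut}(\Omega,p)$ to $\Lambda$ are connected coverings. If $p:\Omega\to\Lambda$ and $q:\Omega\to\Gamma$ are coverings with the same domain, a morphism $(\Omega,p)\to(\Omega,q)$ is a $k$-graph morphism $\phi:\Lambda\to\Gamma$ with $\phi\circ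 p=q$; this is the notion of isomorphism used in (iv). *)

theory Defs
  imports "HOL-Algebra.Group_Action" "HOL-Library.Function_Algebras"
begin

section \<open>Small categories, functors, groupoids\<close>

text \<open>
  Composition is written as for functions: \<open>\<alpha> \<cdot> \<beta>\<close> is meaningful when \<open>src \<alpha> = rng \<beta>\<close>.
  The values of the operations outside \<open>Obj\<close>, \<open>Mor\<close> and the composable pairs are irrelevant.
\<close>

record ('o, 'm) cat =
  Obj :: "'o set"
  Mor :: "'m set"
  src :: "'m \<Rightarrow> 'o"
  rng :: "'m \<Rightarrow> 'o"
  ident :: "'o \<Rightarrow> 'm"
  cat_comp :: "'m \<Rightarrow> 'm \<Rightarrow> 'm"  (infixl "\<cdot>\<index>" 70)

locale category =
  fixes C :: "('o, 'm, 'z) cat_scheme" (structure)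
  assumes src_closed: "\<alpha> \<in> Mor C \<Longrightarrow> src C \<alpha> \<in> Obj C"
    and rng_closed: "\<alpha> \<in> Mor C \<Longrightarrow> rng C \<alpha> \<in> Obj C"
    and ident_closed: "u \<in> Obj C \<Longrightarrow> ident C u \<in> Mor C"
    and src_ident: "u \<in> Obj C \<Longrightarrow> src C (ident C u) = u"
    and rng_ident: "u \<in> Obj C \<Longrightarrow> rng C (ident C u) = u"
    and comp_closed: "\<lbrakk>\<alpha> \<in> Mor C; \<beta> \<in> Mor C; src C \<alpha> = rng C \<beta>\<rbrakk> \<Longrightarrow> \<alpha> \<cdot> \<beta> \<in> Mor C"
    and src_comp: "\<lbrakk>\<alpha> \<in> Mor C; \<beta> \<in> Mor C; src C \<alpha> = rng C \<beta>\<rbrakk> \<Longrightarrow> src C (\<alpha> \<cdot> \<beta>) = src C \<beta>"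
    and rng_comp: "\<lbrakk>\<alpha> \<in> Mor C; \<beta> \<in> Mor C; src C \<alpha> = rng C \<beta>\<rbrakk> \<Longrightarrow> rng C (\<alpha> \<cdot> \<beta>) = rng C \<alpha>"
    and comp_assoc: "\<lbrakk>\<alpha> \<in> Mor C; \<beta> \<in> Mor C; \<gamma> \<in> Mor C; src C \<alpha> = rng C \<beta>; src C \<beta> = rng C \<gamma>\<rbrakk>
        \<Longrightarrow> (\<alpha> \<cdot> \<beta>) \<cdot> \<gamma> = \<alpha> \<cdot> (\<beta> \<cdot> \<gamma>)"
    and comp_ident_left: "\<alpha> \<in> Mor C \<Longrightarrow> ident C (rng C \<alpha>) \<cdot> \<alpha> = \<alpha>"
    and comp_ident_right: "\<alpha> \<in> Mor C \<Longrightarrow> \<alpha> \<cdot> ident C (src C \<alpha>) = \<alpha>"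

definition hom_set :: "('o, 'm, 'z) cat_scheme \<Rightarrow> 'o \<Rightarrow> 'o \<Rightarrow> 'm set" where
  "hom_set C u v = {\<alpha> \<in> Mor C. rng C \<alpha> = u \<and> src C \<alpha> = v}"

definition connected_cat :: "('o, 'm, 'z) cat_scheme \<Rightarrow> bool" where
  "connected_cat C \<longleftrightarrow>
    (\<forall>u \<in> Obj C. \<forall>v \<in> Obj C. equivclp (\<lambda>a b. hom_set C a b \<noteq> {}) u v)"

record ('o1, 'm1, 'o2, 'm2) fmap =
  on_obj :: "'o1 \<Rightarrow> 'o2"
  on_mor :: "'m1 \<Rightarrow> 'm2"

definition is_functor ::
    "('o1, 'm1, 'z1) cat_scheme \<Rightarrow> ('o2, 'm2, 'z2) cat_scheme \<Rightarrow> ('o1, 'm1, 'o2, 'm2) fmap \<Rightarrow> bool" where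
  "is_functor C D F \<longleftrightarrow> category C \<and> category D \<and>
    (\<forall>u \<in> Obj C. on_obj F u \<in> Obj D) \<and>
    (\<forall>\<alpha> \<in> Mor C. on_mor F \<alpha> \<in> Mor D \<and>
       src D (on_mor F \<alpha>) = on_obj F (src C \<alpha>) \<and> rng D (on_mor F \<alpha>) = on_obj F (rng C \<alpha>)) \<and>
    (\<forall>u \<in> Obj C. on_mor F (ident C u) = ident D (on_obj F u)) \<and>
    (\<forall>\<alpha> \<in> Mor C. \<forall>\<beta> \<in> Mor C. src C \<alpha> = rng C \<beta> \<longrightarrow>
       on_mor F (\<alpha> \<cdot>\<^bsub>C\<^esub> \<beta>) = on_mor F \<alpha> \<cdot>\<^bsub>D\<^esub> on_mor F \<beta>)"

definition fid :: "('o, 'm, 'o, 'm) fmap" where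
  "fid = \<lparr>on_obj = (\<lambda>u. u), on_mor = (\<lambda>\<alpha>. \<alpha>)\<rparr>"

definition fcomp ::
    "('o2, 'm2, 'o3, 'm3) fmap \<Rightarrow> ('o1, 'm1, 'o2, 'm2) fmap \<Rightarrow> ('o1, 'm1, 'o3, 'm3) fmap" where
  "fcomp G F = \<lparr>on_obj = on_obj G \<circ> on_obj F, on_mor = on_mor G \<circ> on_mor F\<rparr>"

text \<open>Equality of functors with domain \<open>C\<close>: junk values outside \<open>C\<close> are disregarded.\<close>

definition feq_on ::
    "('o1, 'm1, 'z) cat_scheme \<Rightarrow> ('o1, 'm1, 'o2, 'm2) fmap \<Rightarrow> ('o1, 'm1, 'o2, 'm2) fmap \<Rightarrow> bool" where
  "feq_on C F G \<longleftrightarrow>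
    (\<forall>u \<in> Obj C. on_obj F u = on_obj G u) \<and> (\<forall>\<alpha> \<in> Mor C. on_mor F \<alpha> = on_mor G \<alpha>)"

definition is_inverse :: "('o, 'm, 'z) cat_scheme \<Rightarrow> 'm \<Rightarrow> 'm \<Rightarrow> bool" where
  "is_inverse C g h \<longleftrightarrow> h \<in> Mor C \<and> src C h = rng C g \<and> rng C h = src C g \<and>
    h \<cdot>\<^bsub>C\<^esub> g = ident C (src C g) \<and> g \<cdot>\<^bsub>C\<^esub> h = ident C (rng C g)"

locale groupoid = category +
  assumes ex_inverse: "g \<in> Mor C \<Longrightarrow> \<exists>h. is_inverse C g h"

definition gpd_inv :: "('o, 'm, 'z) cat_scheme \<Rightarrow> 'm \<Rightarrow> 'm" where
  "gpd_inv C g = (THE h. is_inverse C g h)"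


section \<open>$k$-graphs and coverings\<close>

record ('o, 'm) kgraph = "('o, 'm) cat" +
  deg :: "'m \<Rightarrow> nat \<Rightarrow> nat"

text \<open>
  \<open>\<nat>\<^sup>k\<close> is encoded by the functions supported in \<open>{..<k}\<close>; this keeps \<open>k\<close> an ordinary
  natural number (\<open>k = 0\<close> included). Addition and \<open>0\<close> are pointwise (\<open>Function_Algebras\<close>).
\<close>

definition Nk :: "nat \<Rightarrow> (nat \<Rightarrow> nat) set" where
  "Nk k = {n. \<forall>i \<ge> k. n i = 0}"

locale k_graph = category \<Lambda> for k :: nat and \<Lambda> :: "('o, 'm) kgraph" (structure) +
  assumes deg_closed: "\<alpha> \<in> Mor \<Lambda> \<Longrightarrow> deg \<Lambda> \<alpha> \<in> Nk k"
    and deg_ident: "u \<in> Obj \<Lambda> \<Longrightarrow> deg \<Lambda> (ident \<Lambda> u) = 0"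
    and deg_comp: "\<lbrakk>\<alpha> \<in> Mor \<Lambda>; \<beta> \<in> Mor \<Lambda>; src \<Lambda> \<alpha> = rng \<Lambda> \<beta>\<rbrakk>
        \<Longrightarrow> deg \<Lambda> (\<alpha> \<cdot> \<beta>) = deg \<Lambda> \<alpha> + deg \<Lambda> \<beta>"
    and factorization: "\<lbrakk>\<alpha> \<in> Mor \<Lambda>; n \<in> Nk k; l \<in> Nk k; deg \<Lambda> \<alpha> = n + l\<rbrakk>
        \<Longrightarrow> \<exists>!(\<beta>, \<gamma>). \<beta> \<in> Mor \<Lambda> \<and> \<gamma> \<in> Mor \<Lambda> \<and> src \<Lambda> \<beta> = rng \<Lambda> \<gamma> \<and>
              deg \<Lambda> \<beta> = n \<and> deg \<Lambda> \<gamma> = l \<and> \<alpha> = \<beta> \<cdot> \<gamma>"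

definition kgraph_morphism ::
    "('o1, 'm1) kgraph \<Rightarrow> ('o2, 'm2) kgraph \<Rightarrow> ('o1, 'm1, 'o2, 'm2) fmap \<Rightarrow> bool" where
  "kgraph_morphism \<Omega> \<Lambda> F \<longleftrightarrow>
    is_functor \<Omega> \<Lambda> F \<and> (\<forall>\<alpha> \<in> Mor \<Omega>. deg \<Lambda> (on_mor F \<alpha>) = deg \<Omega> \<alpha>)"

definition kgraph_iso ::
    "('o1, 'm1) kgraph \<Rightarrow> ('o2, 'm2) kgraph \<Rightarrow> ('o1, 'm1, 'o2, 'm2) fmap \<Rightarrow> bool" where
  "kgraph_iso \<Omega> \<Lambda> F \<longleftrightarrow> kgraph_morphism \<Omega> \<Lambda> F \<and>
    (\<exists>G. kgraph_morphism \<Lambda> \<Omega> G \<and> feq_on \<Omega> (fcomp G F) fid \<and> feq_on \<Lambda> (fcomp F G) fid)"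

definition covering ::
    "nat \<Rightarrow> ('o1, 'm1) kgraph \<Rightarrow> ('o2, 'm2) kgraph \<Rightarrow> ('o1, 'm1, 'o2, 'm2) fmap \<Rightarrow> bool" where
  "covering k \<Omega> \<Lambda> p \<longleftrightarrow> k_graph k \<Omega> \<and> k_graph k \<Lambda> \<and> kgraph_morphism \<Omega> \<Lambda> p \<and>
    on_obj p ` Obj \<Omega> = Obj \<Lambda> \<and> on_mor p ` Mor \<Omega> = Mor \<Lambda> \<and>
    (\<forall>v \<in> Obj \<Omega>.
      bij_betw (on_mor p) {\<alpha> \<in> Mor \<Omega>. src \<Omega> \<alpha> = v} {\<alpha> \<in> Mor \<Lambda>. src \<Lambda> \<alpha> = on_obj p v} \<and>
      bij_betw (on_mor p) {\<alpha> \<in> Mor \<Omega>. rng \<Omega> \<alpha> = v} {\<alpha> \<in> Mor \<Lambda>. rng \<Lambda> \<alpha> = on_obj p v})"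

definition connected_covering ::
    "nat \<Rightarrow> ('o1, 'm1) kgraph \<Rightarrow> ('o2, 'm2) kgraph \<Rightarrow> ('o1, 'm1, 'o2, 'm2) fmap \<Rightarrow> bool" where
  "connected_covering k \<Omega> \<Lambda> p \<longleftrightarrow> covering k \<Omega> \<Lambda> p \<and> connected_cat \<Omega>"

definition vertex_fibre ::
    "('o1, 'm1, 'z) cat_scheme \<Rightarrow> ('o1, 'm1, 'o2, 'm2) fmap \<Rightarrow> 'o2 \<Rightarrow> 'o1 set" where
  "vertex_fibre \<Omega> p x = {v \<in> Obj \<Omega>. on_obj p v = x}"


section \<open>The automorphism group of a covering and the quotient covering\<close>

text \<open>
  As in \<^const>\<open>BijGroup\<close>, elements are extensional, so that an automorphism is determined
  by its values on \<open>\<Omega>\<close>.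
\<close>

definition Aut :: "('o1, 'm1) kgraph \<Rightarrow> ('o1, 'm1, 'o2, 'm2) fmap \<Rightarrow> ('o1, 'm1, 'o1, 'm1) fmap monoid" where
  "Aut \<Omega> p =
    \<lparr>carrier = {\<phi>. on_obj \<phi> \<in> extensional (Obj \<Omega>) \<and> on_mor \<phi> \<in> extensional (Mor \<Omega>) \<and>
                  kgraph_iso \<Omega> \<Omega> \<phi> \<and> feq_on \<Omega> (fcomp p \<phi>) p},
     mult = \<lambda>\<phi> \<psi>. \<lparr>on_obj = compose (Obj \<Omega>) (on_obj \<phi>) (on_obj \<psi>),
                     on_mor = compose (Mor \<Omega>) (on_mor \<phi>) (on_mor \<psi>)\<rparr>,
     one = \<lparr>on_obj = restrict (\<lambda>u. u) (Obj \<Omega>), on_mor = restrict (\<lambda>\<alpha>. \<alpha>) (Mor \<Omega>)\<rparr>\<rparr>"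

text \<open>
  The \<open>Aut(\<Omega>, p)\<close>-orbits \<open>[u]\<close> and \<open>[\<alpha>]\<close> of vertices and morphisms. In \<open>quotient_kgraph\<close> and
  \<open>quotient_induced\<close>, \<^const>\<open>the_elem\<close> picks the value common to all admissible choices of
  representatives.
\<close>

abbreviation obj_orbit :: "('o1, 'm1) kgraph \<Rightarrow> ('o1, 'm1, 'o2, 'm2) fmap \<Rightarrow> 'o1 \<Rightarrow> 'o1 set" where
  "obj_orbit \<Omega> p \<equiv> orbit (Aut \<Omega> p) on_obj"

abbreviation mor_orbit :: "('o1, 'm1) kgraph \<Rightarrow> ('o1, 'm1, 'o2, 'm2) fmap \<Rightarrow> 'm1 \<Rightarrow> 'm1 set" where
  "mor_orbit \<Omega> p \<equiv> orbit (Aut \<Omega> p) on_mor"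

definition quotient_kgraph ::
    "('o1, 'm1) kgraph \<Rightarrow> ('o1, 'm1, 'o2, 'm2) fmap \<Rightarrow> ('o1 set, 'm1 set) kgraph" where
  "quotient_kgraph \<Omega> p =
    \<lparr>Obj = orbits (Aut \<Omega> p) (Obj \<Omega>) on_obj,
     Mor = orbits (Aut \<Omega> p) (Mor \<Omega>) on_mor,
     src = \<lambda>A. the_elem {obj_orbit \<Omega> p (src \<Omega> \<alpha>) | \<alpha>. \<alpha> \<in> A},
     rng = \<lambda>A. the_elem {obj_orbit \<Omega> p (rng \<Omega> \<alpha>) | \<alpha>. \<alpha> \<in> A},
     ident = \<lambda>U. the_elem {mor_orbit \<Omega> p (ident \<Omega> u) | u. u \<in> U},
     cat_comp = \<lambda>A B. the_elem {mor_orbit \<Omega> p (\<alpha> \<cdot>\<^bsub>\<Omega>\<^esub> \<beta>) | \<alpha> \<beta>.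
                                 \<alpha> \<in> A \<and> \<beta> \<in> B \<and> src \<Omega> \<alpha> = rng \<Omega> \<beta>},
     deg = \<lambda>A. the_elem {deg \<Omega> \<alpha> | \<alpha>. \<alpha> \<in> A}\<rparr>"

definition quotient_map ::
    "('o1, 'm1) kgraph \<Rightarrow> ('o1, 'm1, 'o2, 'm2) fmap \<Rightarrow> ('o1, 'm1, 'o1 set, 'm1 set) fmap" where
  "quotient_map \<Omega> p = \<lparr>on_obj = obj_orbit \<Omega> p, on_mor = mor_orbit \<Omega> p\<rparr>"

definition quotient_induced ::
    "('o1, 'm1, 'o2, 'm2) fmap \<Rightarrow> ('o1 set, 'm1 set, 'o2, 'm2) fmap" where
  "quotient_induced p =
    \<lparr>on_obj = \<lambda>U. the_elem (on_obj p ` U), on_mor = \<lambda>A. the_elem (on_mor p ` A)\<rparr>"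

text \<open>
  Coverings \<open>p : \<Omega> \<rightarrow> \<Lambda>\<close>, \<open>q : \<Omega> \<rightarrow> \<Gamma>\<close> with common domain: a morphism from \<open>(\<Omega>, p)\<close> to
  \<open>(\<Omega>, q)\<close> is a $k$-graph morphism \<open>\<phi> : \<Lambda> \<rightarrow> \<Gamma>\<close> with \<open>\<phi> \<circ> p = q\<close>.
\<close>

definition under_morphism ::
    "('o, 'm) kgraph \<Rightarrow> ('o1, 'm1) kgraph \<Rightarrow> ('o, 'm, 'o1, 'm1) fmap \<Rightarrow>
     ('o2, 'm2) kgraph \<Rightarrow> ('o, 'm, 'o2, 'm2) fmap \<Rightarrow> ('o1, 'm1, 'o2, 'm2) fmap \<Rightarrow> bool" where
  "under_morphism \<Omega> \<Lambda> p \<Gamma> q \<phi> \<longleftrightarrow> kgraph_morphism \<Lambda> \<Gamma> \<phi> \<and> feq_on \<Omega> (fcomp \<phi> p) q"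

definition under_isomorphic ::
    "('o, 'm) kgraph \<Rightarrow> ('o1, 'm1) kgraph \<Rightarrow> ('o, 'm, 'o1, 'm1) fmap \<Rightarrow>
     ('o2, 'm2) kgraph \<Rightarrow> ('o, 'm, 'o2, 'm2) fmap \<Rightarrow> bool" where
  "under_isomorphic \<Omega> \<Lambda> p \<Gamma> q \<longleftrightarrow>
    (\<exists>\<phi> \<psi>. under_morphism \<Omega> \<Lambda> p \<Gamma> q \<phi> \<and> under_morphism \<Omega> \<Gamma> q \<Lambda> p \<psi> \<and>
           feq_on \<Lambda> (fcomp \<psi> \<phi>) fid \<and> feq_on \<Gamma> (fcomp \<phi> \<psi>) fid)"


section \<open>The fundamental groupoid\<close>

text \<open>
  A model of the fundamental groupoid: formal composites of morphisms and of their formal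
  inverses, modulo the relations of the category and \<open>\<alpha> \<alpha>\<inverse> = 1\<close>, \<open>\<alpha>\<inverse> \<alpha> = 1\<close>. A path
  \<open>(u, w, v)\<close> has range \<open>u\<close> and source \<open>v\<close>, and its word is read like a composite, range first.
  The universal property, for groupoids of arbitrary type, is the theorem
  \<open>fund_groupoid_universal\<close> below.
\<close>

datatype 'm letter = Fwd 'm | Bwd 'm

fun letter_mor :: "'m letter \<Rightarrow> 'm" where
  "letter_mor (Fwd \<alpha>) = \<alpha>"
| "letter_mor (Bwd \<alpha>) = \<alpha>"

fun letter_src :: "('o, 'm, 'z) cat_scheme \<Rightarrow> 'm letter \<Rightarrow> 'o" where
  "letter_src C (Fwd \<alpha>) = src C \<alpha>"
| "letter_src C (Bwd \<alpha>) = rng C \<alpha>"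

fun letter_rng :: "('o, 'm, 'z) cat_scheme \<Rightarrow> 'm letter \<Rightarrow> 'o" where
  "letter_rng C (Fwd \<alpha>) = rng C \<alpha>"
| "letter_rng C (Bwd \<alpha>) = src C \<alpha>"

type_synonym ('o, 'm) zpath = "'o \<times> 'm letter list \<times> 'o"

fun is_word :: "('o, 'm, 'z) cat_scheme \<Rightarrow> 'o \<Rightarrow> 'm letter list \<Rightarrow> 'o \<Rightarrow> bool" where
  "is_word C u [] v \<longleftrightarrow> u \<in> Obj C \<and> u = v"
| "is_word C u (a # w) v \<longleftrightarrow>
     letter_mor a \<in> Mor C \<and> letter_rng C a = u \<and> is_word C (letter_src C a) w v"

definition zpaths :: "('o, 'm, 'z) cat_scheme \<Rightarrow> ('o, 'm) zpath set" where
  "zpaths C = {(u, w, v). is_word C u w v}"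

inductive word_rel :: "('o, 'm, 'z) cat_scheme \<Rightarrow> 'm letter list \<Rightarrow> 'm letter list \<Rightarrow> bool"
  for C :: "('o, 'm, 'z) cat_scheme" where
  compose: "\<lbrakk>\<alpha> \<in> Mor C; \<beta> \<in> Mor C; src C \<alpha> = rng C \<beta>\<rbrakk>
     \<Longrightarrow> word_rel C [Fwd \<alpha>, Fwd \<beta>] [Fwd (\<alpha> \<cdot>\<^bsub>C\<^esub> \<beta>)]"
| ident: "u \<in> Obj C \<Longrightarrow> word_rel C [Fwd (ident C u)] []"
| cancel_right: "\<alpha> \<in> Mor C \<Longrightarrow> word_rel C [Fwd \<alpha>, Bwd \<alpha>] []"
| cancel_left: "\<alpha> \<in> Mor C \<Longrightarrow> word_rel C [Bwd \<alpha>, Fwd \<alpha>] []"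

inductive zstep :: "('o, 'm, 'z) cat_scheme \<Rightarrow> ('o, 'm) zpath \<Rightarrow> ('o, 'm) zpath \<Rightarrow> bool"
  for C :: "('o, 'm, 'z) cat_scheme" where
  zstep: "\<lbrakk>word_rel C l r; (u, a @ l @ b, v) \<in> zpaths C; (u, a @ r @ b, v) \<in> zpaths C\<rbrakk>
     \<Longrightarrow> zstep C (u, a @ l @ b, v) (u, a @ r @ b, v)"

definition zclass :: "('o, 'm, 'z) cat_scheme \<Rightarrow> ('o, 'm) zpath \<Rightarrow> ('o, 'm) zpath set" where
  "zclass C P = {Q. equivclp (zstep C) P Q}"

fun zconcat :: "('o, 'm) zpath \<Rightarrow> ('o, 'm) zpath \<Rightarrow> ('o, 'm) zpath" where
  "zconcat (u, w, v) (u', w', v') = (u, w @ w', v')"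

definition fund_groupoid :: "('o, 'm, 'z) cat_scheme \<Rightarrow> ('o, ('o, 'm) zpath set) cat" where
  "fund_groupoid C =
    \<lparr>Obj = Obj C,
     Mor = zclass C ` zpaths C,
     src = \<lambda>g. the_elem ((\<lambda>(u, w, v). v) ` g),
     rng = \<lambda>g. the_elem ((\<lambda>(u, w, v). u) ` g),
     ident = \<lambda>u. zclass C (u, [], u),
     cat_comp = \<lambda>g h. the_elem ((\<lambda>(P, Q). zclass C (zconcat P Q)) ` (g \<times> h))\<rparr>"

definition fund_incl :: "('o, 'm, 'z) cat_scheme \<Rightarrow> ('o, 'm, 'o, ('o, 'm) zpath set) fmap" where
  "fund_incl C =
    \<lparr>on_obj = (\<lambda>u. u), on_mor = (\<lambda>\<alpha>. zclass C (rng C \<alpha>, [Fwd \<alpha>], src C \<alpha>))\<rparr>"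

fun letter_value ::
    "('o2, 'm2, 'z) cat_scheme \<Rightarrow> ('o1, 'm1, 'o2, 'm2) fmap \<Rightarrow> 'm1 letter \<Rightarrow> 'm2" where
  "letter_value H F (Fwd \<alpha>) = on_mor F \<alpha>"
| "letter_value H F (Bwd \<alpha>) = gpd_inv H (on_mor F \<alpha>)"

fun path_value ::
    "('o2, 'm2, 'z) cat_scheme \<Rightarrow> ('o1, 'm1, 'o2, 'm2) fmap \<Rightarrow> ('o1, 'm1) zpath \<Rightarrow> 'm2" where
  "path_value H F (u, w, v) =
     foldr (\<lambda>a g. letter_value H F a \<cdot>\<^bsub>H\<^esub> g) w (ident H (on_obj F v))"

text \<open>The factorization through \<^const>\<open>fund_incl\<close> of a functor \<open>F\<close> into a groupoid \<open>H\<close>.\<close>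

definition fund_lift ::
    "('o2, 'm2, 'z) cat_scheme \<Rightarrow> ('o1, 'm1, 'o2, 'm2) fmap \<Rightarrow>
     ('o1, ('o1, 'm1) zpath set, 'o2, 'm2) fmap" where
  "fund_lift H F = \<lparr>on_obj = on_obj F, on_mor = (\<lambda>g. the_elem (path_value H F ` g))\<rparr>"

definition fund_group ::
    "('o, 'm, 'z) cat_scheme \<Rightarrow> 'o \<Rightarrow> ('o, 'm) zpath set monoid" where
  "fund_group C x =
    \<lparr>carrier = hom_set (fund_groupoid C) x x,
     mult = cat_comp (fund_groupoid C),
     one = ident (fund_groupoid C) x\<rparr>"

text \<open>\<open>p\<^sub>*\<close>: the functor of fundamental groupoids induced by a functor \<open>p\<close> into \<open>\<Lambda>\<close>.\<close>

definition induced_map ::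
    "('o2, 'm2, 'z2) cat_scheme \<Rightarrow> ('o1, 'm1, 'o2, 'm2) fmap \<Rightarrow>
     ('o1, 'm1) zpath set \<Rightarrow> ('o2, 'm2) zpath set" where
  "induced_map \<Lambda> p = on_mor (fund_lift (fund_groupoid \<Lambda>) (fcomp (fund_incl \<Lambda>) p))"



subsection \<open>The universal property\<close>

lemma equivclp_invariant:
  assumes "equivclp r x y" "\<And>a b. r a b \<Longrightarrow> f a = f b"
  shows "f x = f y"
  using assms(1) unfolding equivclp_def
  by (induction rule: rtranclp_induct) (auto elim!: symclpE dest: assms(2))

lemma equivclp_map:
  assumes "equivclp r x y" "\<And>a b. r a b \<Longrightarrow> equivclp r (f a) (f b)"
  shows "equivclp r (f x) (f y)"
  using assms(1) unfolding equivclp_def[of r]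
proof (induction rule: rtranclp_induct)
  case (step y z)
  then have "equivclp r (f y) (f z)"
    by (auto elim!: symclpE dest: assms(2) intro: equivclp_sym)
  with step.IH show ?case
    unfolding equivclp_def by (rule rtranclp_trans)
qed simp

lemma zclass_self: "P \<in> zclass C P"
  by (simp add: zclass_def)

lemma zclass_eq_iff: "zclass C P = zclass C Q \<longleftrightarrow> equivclp (zstep C) P Q"
proof
  assume "zclass C P = zclass C Q"
  then have "Q \<in> zclass C P" using zclass_self[of Q C] by (simp only:)
  then show "equivclp (zstep C) P Q" by (simp add: zclass_def)
next
  assume "equivclp (zstep C) P Q"
  then have "equivclp (zstep C) P R \<longleftrightarrow> equivclp (zstep C) Q R" for R
    using equivclp_sym equivclp_trans by metis
  then show "zclass C P = zclass C Q" by (simp add: zclass_def)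
qed

lemma the_elem_zclass:
  assumes "\<And>P Q. zstep C P Q \<Longrightarrow> f P = f Q"
  shows "the_elem (f ` zclass C P) = f P"
proof (rule the_elem_image_unique)
  show "zclass C P \<noteq> {}" using zclass_self by blast
  show "f Q = f P" if "Q \<in> zclass C P" for Q
    using that equivclp_invariant[of "zstep C" P Q f] assms by (auto simp: zclass_def)
qed

lemma zstep_paths: "zstep C P Q \<Longrightarrow> P \<in> zpaths C \<and> Q \<in> zpaths C"
  by (auto elim: zstep.cases)

lemma zstep_ends: "zstep C P Q \<Longrightarrow> fst P = fst Q \<and> snd (snd P) = snd (snd Q)"
  by (auto elim: zstep.cases)

lemma zclass_ends:
  assumes "Q \<in> zclass C P"
  shows "fst Q = fst P" "snd (snd Q) = snd (snd P)"
proof -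
  have "equivclp (zstep C) P Q" using assms by (simp add: zclass_def)
  then show "fst Q = fst P" "snd (snd Q) = snd (snd P)"
    using equivclp_invariant[of "zstep C" P Q fst]
      equivclp_invariant[of "zstep C" P Q "\<lambda>P. snd (snd P)"] zstep_ends
    by metis+
qed

lemma zclass_paths:
  assumes "P \<in> zpaths C" "Q \<in> zclass C P"
  shows "Q \<in> zpaths C"
proof -
  have "equivclp (zstep C) P Q" using assms by (simp add: zclass_def)
  then show ?thesis
    using assms(1) equivclp_invariant[of "zstep C" P Q "\<lambda>P. P \<in> zpaths C"] zstep_paths by metis
qed

lemma fund_src: "src (fund_groupoid C) (zclass C (u, w, v)) = v"
  unfolding fund_groupoid_def
  by (simp, subst the_elem_zclass) (auto dest: zstep_ends)

lemma fund_rng: "rng (fund_groupoid C) (zclass C (u, w, v)) = u"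
  unfolding fund_groupoid_def
  by (simp, subst the_elem_zclass) (auto dest: zstep_ends)

lemma fund_Obj: "Obj (fund_groupoid C) = Obj C"
  by (simp add: fund_groupoid_def)

lemma fund_Mor: "Mor (fund_groupoid C) = zclass C ` zpaths C"
  by (simp add: fund_groupoid_def)

lemma fund_ident: "ident (fund_groupoid C) u = zclass C (u, [], u)"
  by (simp add: fund_groupoid_def)

context category
begin

lemma is_word_Obj: "is_word C u w v \<Longrightarrow> u \<in> Obj C \<and> v \<in> Obj C"
proof (induction w arbitrary: u)
  case (Cons a w)
  then show ?case by (cases a) (auto intro: src_closed rng_closed)
qed auto

lemma is_word_append:
  "is_word C u (w @ w') v \<longleftrightarrow> (\<exists>t. is_word C u w t \<and> is_word C t w' v)"
  by (induction w arbitrary: u) (auto dest: is_word_Obj)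

lemma zstep_concat_right:
  assumes "zstep C P P'" "snd (snd P) = t" "is_word C t w v"
  shows "zstep C (zconcat P (t, w, v)) (zconcat P' (t, w, v))"
  using assms(1)
proof cases
  case (zstep l r u a b v')
  then have "is_word C u (a @ l @ b) t" "is_word C u (a @ r @ b) t"
    using assms(2) by (auto simp: zpaths_def)
  then have "is_word C u (a @ l @ b @ w) v" "is_word C u (a @ r @ b @ w) v"
    using assms(3) is_word_append[of u "a @ l @ b" w v] is_word_append[of u "a @ r @ b" w v]
    by auto
  then show ?thesis
    using zstep.zstep[OF zstep(3), of u a "b @ w" v] zstep(1,2) by (simp add: zpaths_def)
qed

lemma zstep_concat_left:
  assumes "zstep C Q Q'" "fst Q = t" "is_word C u w t"
  shows "zstep C (zconcat (u, w, t) Q) (zconcat (u, w, t) Q')"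
  using assms(1)
proof cases
  case (zstep l r u' a b v)
  then have "is_word C t (a @ l @ b) v" "is_word C t (a @ r @ b) v"
    using assms(2) by (auto simp: zpaths_def)
  then have "is_word C u ((w @ a) @ l @ b) v" "is_word C u ((w @ a) @ r @ b) v"
    using assms(3) is_word_append[of u w "a @ l @ b" v] is_word_append[of u w "a @ r @ b" v]
    by auto
  then show ?thesis
    using zstep.zstep[OF zstep(3), of u "w @ a" b v] zstep(1,2) by (simp add: zpaths_def)
qed

lemma equivclp_concat:
  assumes P: "equivclp (zstep C) (u, w, t) P" and Q: "equivclp (zstep C) (t, w', v) Q"
    and w: "is_word C u w t" and w': "is_word C t w' v"
  shows "equivclp (zstep C) (u, w @ w', v) (zconcat P Q)"
proof -
  have *: "equivclp (zstep C) (zconcat P (t, w', v)) (zconcat P' (t, w', v))"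
    if "zstep C P P'" "snd (snd P) = t" for P P'
    using zstep_concat_right[OF that w'] by auto
  have "equivclp (zstep C) (u, w @ w', v) (zconcat P (t, w', v))"
  proof -
    define f where "f P = (if snd (snd P) = t then zconcat P (t, w', v) else (u, w, t))" for P
    have "equivclp (zstep C) (f (u, w, t)) (f P)"
      by (rule equivclp_map[OF P]) (auto simp: f_def * dest: zstep_ends)
    moreover have "snd (snd P) = t" using P zclass_ends[of P C "(u, w, t)"] by (auto simp: zclass_def)
    ultimately show ?thesis by (simp add: f_def)
  qed
  moreover have "equivclp (zstep C) (zconcat P (t, w', v)) (zconcat P Q)"
  proof -
    have P': "fst P = u" "snd (snd P) = t" "P \<in> zpaths C"
      using P w zclass_ends[of P C "(u, w, t)"] zclass_paths[of "(u, w, t)" C P]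
      by (auto simp: zclass_def zpaths_def)
    then obtain x where x: "P = (u, x, t)" "is_word C u x t" by (cases P) (auto simp: zpaths_def)
    define f where "f Q = (if fst Q = t then zconcat P Q else (u, w, t))" for Q
    have "equivclp (zstep C) (f (t, w', v)) (f Q)"
    proof (rule equivclp_map[OF Q])
      fix a b assume ab: "zstep C a b"
      show "equivclp (zstep C) (f a) (f b)"
        using zstep_concat_left[OF ab _ x(2)] zstep_ends[OF ab] x by (auto simp: f_def)
    qed
    moreover have "fst Q = t" using Q zclass_ends[of Q C "(t, w', v)"] by (auto simp: zclass_def)
    ultimately show ?thesis by (simp add: f_def)
  qed
  ultimately show ?thesis by (rule equivclp_trans)
qed

lemma fund_comp:
  assumes "is_word C u w t" "is_word C t w' v"
  shows "zclass C (u, w, t) \<cdot>\<^bsub>fund_groupoid C\<^esub> zclass C (t, w', v) = zclass C (u, w @ w', v)"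
proof -
  let ?f = "\<lambda>(P, Q). zclass C (zconcat P Q)"
  have "the_elem (?f ` (zclass C (u, w, t) \<times> zclass C (t, w', v))) = ?f ((u, w, t), (t, w', v))"
  proof (rule the_elem_image_unique)
    show "zclass C (u, w, t) \<times> zclass C (t, w', v) \<noteq> {}" using zclass_self by blast
  next
    fix R assume "R \<in> zclass C (u, w, t) \<times> zclass C (t, w', v)"
    then obtain P Q where R: "R = (P, Q)" "equivclp (zstep C) (u, w, t) P"
        "equivclp (zstep C) (t, w', v) Q"
      by (auto simp: zclass_def)
    show "?f R = ?f ((u, w, t), (t, w', v))"
      using equivclp_concat[OF R(2,3) assms] by (auto simp: R(1) zclass_eq_iff intro: equivclp_sym)
  qed
  then show ?thesis by (simp add: fund_groupoid_def)
qed

lemma zclass_word_rel: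
  assumes "word_rel C l r" "is_word C u l v" "is_word C u r v"
  shows "zclass C (u, l, v) = zclass C (u, r, v)"
proof -
  have "zstep C (u, l, v) (u, r, v)"
    using zstep.zstep[OF assms(1), of u "[]" "[]" v] assms(2,3) by (simp add: zpaths_def)
  then show ?thesis by (auto simp: zclass_eq_iff)
qed

lemma fund_category: "category (fund_groupoid C)"
proof
  fix g assume "g \<in> Mor (fund_groupoid C)"
  then obtain u w v where g: "g = zclass C (u, w, v)" "is_word C u w v"
    by (auto simp: fund_Mor zpaths_def)
  show "src (fund_groupoid C) g \<in> Obj (fund_groupoid C)"
    "rng (fund_groupoid C) g \<in> Obj (fund_groupoid C)"
    using g is_word_Obj by (auto simp: fund_src fund_rng fund_Obj)
  show "ident (fund_groupoid C) (rng (fund_groupoid C) g) \<cdot>\<^bsub>fund_groupoid C\<^esub> g = g"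
    "g \<cdot>\<^bsub>fund_groupoid C\<^esub> ident (fund_groupoid C) (src (fund_groupoid C) g) = g"
    using g is_word_Obj fund_comp[of u "[]" u w v] fund_comp[of u w v "[]" v]
    by (auto simp: fund_src fund_rng fund_ident)
  fix h assume h: "h \<in> Mor (fund_groupoid C)" and gh: "src (fund_groupoid C) g = rng (fund_groupoid C) h"
  then obtain w' t where h': "h = zclass C (v, w', t)" "is_word C v w' t"
    using g by (auto simp: fund_Mor zpaths_def fund_src fund_rng)
  have c: "g \<cdot>\<^bsub>fund_groupoid C\<^esub> h = zclass C (u, w @ w', t)" "is_word C u (w @ w') t"
    using fund_comp g h' is_word_append by auto
  show "g \<cdot>\<^bsub>fund_groupoid C\<^esub> h \<in> Mor (fund_groupoid C)"
    "src (fund_groupoid C) (g \<cdot>\<^bsub>fund_groupoid C\<^esub> h) = src (fund_groupoid C) h"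
    "rng (fund_groupoid C) (g \<cdot>\<^bsub>fund_groupoid C\<^esub> h) = rng (fund_groupoid C) g"
    using c g h' by (auto simp: fund_Mor zpaths_def fund_src fund_rng)
  fix e assume e: "e \<in> Mor (fund_groupoid C)" and he: "src (fund_groupoid C) h = rng (fund_groupoid C) e"
  then obtain w'' s where e': "e = zclass C (t, w'', s)" "is_word C t w'' s"
    using h' by (auto simp: fund_Mor zpaths_def fund_src fund_rng)
  have "is_word C v (w' @ w'') s" using h' e' is_word_append by auto
  then show "(g \<cdot>\<^bsub>fund_groupoid C\<^esub> h) \<cdot>\<^bsub>fund_groupoid C\<^esub> e = g \<cdot>\<^bsub>fund_groupoid C\<^esub> (h \<cdot>\<^bsub>fund_groupoid C\<^esub> e)"
    using c g h' e' by (simp add: fund_comp)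
next
  fix u assume "u \<in> Obj (fund_groupoid C)"
  then show "ident (fund_groupoid C) u \<in> Mor (fund_groupoid C)"
    "src (fund_groupoid C) (ident (fund_groupoid C) u) = u"
    "rng (fund_groupoid C) (ident (fund_groupoid C) u) = u"
    by (auto simp: fund_Obj fund_Mor fund_ident fund_src fund_rng zpaths_def)
qed

end

fun letter_inv :: "'m letter \<Rightarrow> 'm letter" where
  "letter_inv (Fwd \<alpha>) = Bwd \<alpha>"
| "letter_inv (Bwd \<alpha>) = Fwd \<alpha>"

lemma letter_inv_simps [simp]:
  "letter_inv (letter_inv a) = a" "letter_mor (letter_inv a) = letter_mor a"
  "letter_src C (letter_inv a) = letter_rng C a" "letter_rng C (letter_inv a) = letter_src C a"
  by (cases a; simp)+

context category
begin

lemma letter_closed: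
  "letter_mor a \<in> Mor C \<Longrightarrow> letter_src C a \<in> Obj C \<and> letter_rng C a \<in> Obj C"
  by (cases a) (auto intro: src_closed rng_closed)

lemma is_word_inv: "is_word C u w v \<Longrightarrow> is_word C v (rev (map letter_inv w)) u"
  by (induction w arbitrary: u) (auto simp: is_word_append letter_closed)

lemma zclass_letter_cancel:
  assumes "letter_mor a \<in> Mor C"
  shows "zclass C (letter_rng C a, [a, letter_inv a], letter_rng C a)
       = zclass C (letter_rng C a, [], letter_rng C a)"
proof (rule zclass_word_rel)
  show "word_rel C [a, letter_inv a] []"
    using assms by (cases a) (auto intro: word_rel.intros)
qed (use assms letter_closed[OF assms] in auto)

lemma zclass_cancel:
  "is_word C u w v \<Longrightarrow> zclass C (u, w @ rev (map letter_inv w), u) = zclass C (u, [], u)"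
proof (induction w arbitrary: u)
  case (Cons a w)
  let ?t = "letter_src C a"
  let ?w = "rev (map letter_inv w)"
  have a: "letter_mor a \<in> Mor C" "letter_rng C a = u" and w: "is_word C ?t w v"
    using Cons.prems by auto
  have u: "u \<in> Obj C" "?t \<in> Obj C" using a letter_closed[OF a(1)] by auto
  have wa: "is_word C u [a] ?t" "is_word C ?t [letter_inv a] u" using a u by auto
  have ww: "is_word C ?t (w @ ?w) ?t" using w is_word_inv is_word_append by blast
  have tail: "is_word C ?t ((w @ ?w) @ [letter_inv a]) u"
    using wa ww is_word_append by blast
  have "zclass C (u, (a # w) @ rev (map letter_inv (a # w)), u)
      = zclass C (u, [a] @ ((w @ ?w) @ [letter_inv a]), u)" by simp
  also have "\<dots> = zclass C (u, [a], ?t) \<cdot>\<^bsub>fund_groupoid C\<^esub>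
      (zclass C (?t, w @ ?w, ?t) \<cdot>\<^bsub>fund_groupoid C\<^esub> zclass C (?t, [letter_inv a], u))"
    by (simp only: fund_comp[OF ww wa(2)] fund_comp[OF wa(1) tail])
  also have "\<dots> = zclass C (u, [a], ?t) \<cdot>\<^bsub>fund_groupoid C\<^esub>
      (zclass C (?t, [], ?t) \<cdot>\<^bsub>fund_groupoid C\<^esub> zclass C (?t, [letter_inv a], u))"
    using Cons.IH[OF w] by simp
  also have "\<dots> = zclass C (u, [a, letter_inv a], u)"
    using wa u by (simp add: fund_comp)
  also have "\<dots> = zclass C (u, [], u)" using zclass_letter_cancel[OF a(1)] a(2) by simp
  finally show ?case .
qed simp

lemma fund_is_inverse:
  assumes "is_word C u w v"
  shows "is_inverse (fund_groupoid C) (zclass C (u, w, v)) (zclass C (v, rev (map letter_inv w), u))"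
proof -
  have "rev (map letter_inv (rev (map letter_inv w))) = w"
    by (simp add: rev_map comp_def)
  then show ?thesis
    using assms is_word_inv[OF assms] zclass_cancel[OF assms] zclass_cancel[OF is_word_inv[OF assms]]
    by (simp add: is_inverse_def fund_src fund_rng fund_ident fund_comp fund_Mor zpaths_def)
qed

lemma fund_groupoid_groupoid: "groupoid (fund_groupoid C)"
proof (rule groupoid.intro[OF fund_category], unfold_locales)
  fix g assume "g \<in> Mor (fund_groupoid C)"
  then show "\<exists>h. is_inverse (fund_groupoid C) g h"
    using fund_is_inverse by (fastforce simp: fund_Mor zpaths_def)
qed

lemma fund_incl_functor: "is_functor C (fund_groupoid C) (fund_incl C)"
proof -
  have "zclass C (u, [Fwd (ident C u)], u) = zclass C (u, [], u)" if "u \<in> Obj C" for u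
    using that by (intro zclass_word_rel word_rel.intros) (auto simp: ident_closed src_ident rng_ident)
  moreover have "zclass C (rng C \<alpha>, [Fwd (\<alpha> \<cdot> \<beta>)], src C \<beta>) =
      zclass C (rng C \<alpha>, [Fwd \<alpha>], src C \<alpha>) \<cdot>\<^bsub>fund_groupoid C\<^esub> zclass C (rng C \<beta>, [Fwd \<beta>], src C \<beta>)"
    if "\<alpha> \<in> Mor C" "\<beta> \<in> Mor C" "src C \<alpha> = rng C \<beta>" for \<alpha> \<beta>
  proof -
    have "zclass C (rng C \<alpha>, [Fwd \<alpha>, Fwd \<beta>], src C \<beta>) = zclass C (rng C \<alpha>, [Fwd (\<alpha> \<cdot> \<beta>)], src C \<beta>)"
      using that by (intro zclass_word_rel word_rel.intros)
        (auto simp: comp_closed src_comp rng_comp src_closed)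
    then show ?thesis using that fund_comp[of "rng C \<alpha>" "[Fwd \<alpha>]" "src C \<alpha>" "[Fwd \<beta>]" "src C \<beta>"]
      by (simp add: src_closed rng_closed)
  qed
  ultimately show ?thesis
    unfolding is_functor_def fund_incl_def
    by (auto simp: category_axioms fund_category fund_Obj fund_Mor fund_src fund_rng fund_ident
        zpaths_def src_closed rng_closed src_comp rng_comp src_ident rng_ident)
qed

end

context groupoid
begin

lemma is_inverse_unique:
  assumes "g \<in> Mor C" "is_inverse C g h" "is_inverse C g h'"
  shows "h = h'"
proof -
  have "h = h \<cdot> (g \<cdot> h')" using assms comp_ident_right[of h] by (simp add: is_inverse_def)
  also have "\<dots> = (h \<cdot> g) \<cdot> h'" using assms comp_assoc[of h g h'] by (simp add: is_inverse_def)
  also have "\<dots> = h'" using assms comp_ident_left[of h'] by (simp add: is_inverse_def)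
  finally show ?thesis .
qed

lemma gpd_inv_eq: "g \<in> Mor C \<Longrightarrow> is_inverse C g h \<Longrightarrow> gpd_inv C g = h"
  unfolding gpd_inv_def using is_inverse_unique by blast

lemma gpd_inv_is_inverse: "g \<in> Mor C \<Longrightarrow> is_inverse C g (gpd_inv C g)"
  using ex_inverse gpd_inv_eq by blast

end

lemma functor_inverse:
  assumes "is_functor C D F" "g \<in> Mor C" "is_inverse C g h"
  shows "is_inverse D (on_mor F g) (on_mor F h)"
  using assms unfolding is_functor_def is_inverse_def
  by (metis category.src_closed category.rng_closed)

locale fund_target = C: category C + H: groupoid H
  for C :: "('o1, 'm1, 'z1) cat_scheme" and H :: "('o2, 'm2, 'z2) cat_scheme" +
  fixes F :: "('o1, 'm1, 'o2, 'm2) fmap"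
  assumes F: "is_functor C H F"
begin

abbreviation val where "val w v \<equiv> path_value H F (undefined, w, v)"

lemma val_Nil: "val [] v = ident H (on_obj F v)"
  by simp

lemma val_Cons: "val (a # w) v = letter_value H F a \<cdot>\<^bsub>H\<^esub> val w v"
  by simp

declare path_value.simps [simp del]

lemma letter_value_closed:
  assumes "letter_mor a \<in> Mor C"
  shows "letter_value H F a \<in> Mor H"
    "src H (letter_value H F a) = on_obj F (letter_src C a)"
    "rng H (letter_value H F a) = on_obj F (letter_rng C a)"
  using assms F H.gpd_inv_is_inverse[of "on_mor F (letter_mor a)"]
  by (cases a; auto simp: is_functor_def is_inverse_def)+

lemma val_closed:
  "is_word C u w v \<Longrightarrow> val w v \<in> Mor H \<and> src H (val w v) = on_obj F v \<and> rng H (val w v) = on_obj F u"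
proof (induction w arbitrary: u)
  case Nil
  then show ?case using F by (auto simp: val_Nil is_functor_def H.ident_closed H.src_ident H.rng_ident)
next
  case (Cons a w)
  then show ?case
    using letter_value_closed[of a]
    by (auto simp: val_Cons H.comp_closed H.src_comp H.rng_comp)
qed

lemma val_append:
  "is_word C u w t \<Longrightarrow> is_word C t w' v \<Longrightarrow> val (w @ w') v = val w t \<cdot>\<^bsub>H\<^esub> val w' v"
proof (induction w arbitrary: u)
  case Nil
  then have "rng H (val w' v) = on_obj F t" "val w' v \<in> Mor H" using val_closed by auto
  then show ?case using H.comp_ident_left[of "val w' v"] by (simp add: val_Nil)
next
  case (Cons a w)
  then show ?case
    using letter_value_closed[of a] val_closed[of "letter_src C a" w t] val_closed[of t w' v]
    by (auto simp: val_Cons H.comp_assoc)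
qed

lemma val_single:
  assumes "letter_mor a \<in> Mor C"
  shows "val [a] (letter_src C a) = letter_value H F a"
  using letter_value_closed[OF assms] H.comp_ident_right[of "letter_value H F a"]
  by (simp add: val_Cons val_Nil)

lemma val_word_rel:
  assumes "word_rel C l r" "is_word C u l v"
  shows "val l v = val r v"
  using assms
proof cases
  case (compose \<alpha> \<beta>)
  have v: "v = src C \<beta>" using assms(2) compose by simp
  have "val [Fwd \<alpha>, Fwd \<beta>] v = on_mor F \<alpha> \<cdot>\<^bsub>H\<^esub> on_mor F \<beta>"
    using val_single[of "Fwd \<beta>"] compose v by (simp add: val_Cons[of "Fwd \<alpha>"])
  moreover have "val [Fwd (\<alpha> \<cdot>\<^bsub>C\<^esub> \<beta>)] v = on_mor F (\<alpha> \<cdot>\<^bsub>C\<^esub> \<beta>)"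
    using val_single[of "Fwd (\<alpha> \<cdot>\<^bsub>C\<^esub> \<beta>)"] compose v by (simp add: C.comp_closed C.src_comp)
  ultimately show ?thesis using F compose by (simp add: is_functor_def)
next
  case (ident u')
  then have "v = u'" using assms(2) C.src_ident by simp
  then show ?thesis
    using val_single[of "Fwd (ident C u')"] ident F
    by (simp add: C.ident_closed C.src_ident val_Nil is_functor_def)
next
  case (cancel_right \<alpha>)
  then have v: "v = rng C \<alpha>" using assms(2) by auto
  have "val [Fwd \<alpha>, Bwd \<alpha>] v = on_mor F \<alpha> \<cdot>\<^bsub>H\<^esub> gpd_inv H (on_mor F \<alpha>)"
    using val_single[of "Bwd \<alpha>"] cancel_right v by (simp add: val_Cons[of "Fwd \<alpha>"])
  then show ?thesis
    using cancel_right v F H.gpd_inv_is_inverse[of "on_mor F \<alpha>"]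
    by (simp add: is_inverse_def is_functor_def val_Nil)
next
  case (cancel_left \<alpha>)
  then have v: "v = src C \<alpha>" using assms(2) by auto
  have "val [Bwd \<alpha>, Fwd \<alpha>] v = gpd_inv H (on_mor F \<alpha>) \<cdot>\<^bsub>H\<^esub> on_mor F \<alpha>"
    using val_single[of "Fwd \<alpha>"] cancel_left v by (simp add: val_Cons[of "Bwd \<alpha>"])
  then show ?thesis
    using cancel_left v F H.gpd_inv_is_inverse[of "on_mor F \<alpha>"]
    by (simp add: is_inverse_def is_functor_def val_Nil)
qed

lemma word_rel_ends:
  assumes "word_rel C l r" "is_word C u l v"
  shows "is_word C u r v"
  using assms
  by cases (auto simp: C.comp_closed C.src_comp C.rng_comp C.src_ident C.rng_ident
      C.src_closed C.rng_closed)

lemma path_value_zstep: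
  assumes "zstep C P Q"
  shows "path_value H F P = path_value H F Q"
  using assms
proof cases
  case (zstep l r u a b v)
  then obtain s t where *: "is_word C u a s" "is_word C s l t" "is_word C t b v"
    by (auto simp: zpaths_def C.is_word_append)
  then have r: "is_word C s r t" using word_rel_ends zstep(3) by blast
  have "val (a @ l @ b) v = val (a @ r @ b) v"
  proof -
    have "is_word C s (l @ b) v" "is_word C s (r @ b) v"
      using *(2,3) r C.is_word_append[of s l b v] C.is_word_append[of s r b v] by auto
    then show ?thesis
      using val_append[OF *(1)] val_append[OF *(2,3)] val_append[OF r *(3)]
        val_word_rel[OF zstep(3) *(2)] by simp
  qed
  then show ?thesis using zstep(1,2) by (simp add: path_value.simps)
qed

lemma lift_zclass: "on_mor (fund_lift H F) (zclass C (u, w, v)) = val w v"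
  unfolding fund_lift_def using path_value_zstep
  by (simp add: the_elem_zclass path_value.simps)

lemma lift_functor: "is_functor (fund_groupoid C) H (fund_lift H F)"
proof -
  have "on_mor (fund_lift H F) (g \<cdot>\<^bsub>fund_groupoid C\<^esub> h) =
      on_mor (fund_lift H F) g \<cdot>\<^bsub>H\<^esub> on_mor (fund_lift H F) h"
    if gh: "g \<in> Mor (fund_groupoid C)" "h \<in> Mor (fund_groupoid C)"
      "src (fund_groupoid C) g = rng (fund_groupoid C) h" for g h
  proof -
    obtain u w v w' t where "g = zclass C (u, w, v)" "is_word C u w v"
      "h = zclass C (v, w', t)" "is_word C v w' t"
      using gh by (auto simp: fund_Mor zpaths_def fund_src fund_rng)
    then show ?thesis by (simp add: C.fund_comp lift_zclass val_append)
  qed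
  moreover have "on_mor (fund_lift H F) g \<in> Mor H \<and>
      src H (on_mor (fund_lift H F) g) = on_obj F (src (fund_groupoid C) g) \<and>
      rng H (on_mor (fund_lift H F) g) = on_obj F (rng (fund_groupoid C) g)"
    if g: "g \<in> Mor (fund_groupoid C)" for g
  proof -
    obtain u w v where "g = zclass C (u, w, v)" "is_word C u w v"
      using g by (auto simp: fund_Mor zpaths_def)
    then show ?thesis using val_closed by (simp add: fund_src fund_rng lift_zclass)
  qed
  moreover have "on_obj (fund_lift H F) = on_obj F" by (simp add: fund_lift_def)
  moreover have "on_mor (fund_lift H F) (ident (fund_groupoid C) u) = ident H (on_obj F u)" for u
    by (simp add: fund_ident lift_zclass val_Nil)
  moreover have "on_obj F u \<in> Obj H" if "u \<in> Obj C" for u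
    using F that by (simp add: is_functor_def)
  ultimately show ?thesis
    using C.fund_category H.category_axioms by (simp add: is_functor_def fund_Obj)
qed

lemma lift_factors: "feq_on C (fcomp (fund_lift H F) (fund_incl C)) F"
proof -
  have "val [Fwd \<alpha>] (src C \<alpha>) = on_mor F \<alpha>" if "\<alpha> \<in> Mor C" for \<alpha>
    using val_single[of "Fwd \<alpha>"] that by simp
  moreover have "on_obj (fund_lift H F) = on_obj F" by (simp add: fund_lift_def)
  ultimately show ?thesis
    by (simp add: feq_on_def fcomp_def fund_incl_def lift_zclass)
qed

lemma lift_unique:
  assumes K: "is_functor (fund_groupoid C) H K" and KF: "feq_on C (fcomp K (fund_incl C)) F"
  shows "feq_on (fund_groupoid C) K (fund_lift H F)"
proof -
  have obj: "on_obj K u = on_obj F u" if "u \<in> Obj C" for u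
    using KF that by (simp add: feq_on_def fcomp_def fund_incl_def)
  have fwd: "on_mor K (zclass C (rng C \<alpha>, [Fwd \<alpha>], src C \<alpha>)) = on_mor F \<alpha>" if "\<alpha> \<in> Mor C" for \<alpha>
    using KF that by (simp add: feq_on_def fcomp_def fund_incl_def)
  have letter: "on_mor K (zclass C (letter_rng C a, [a], letter_src C a)) = letter_value H F a"
    if "letter_mor a \<in> Mor C" for a
  proof (cases a)
    case (Fwd \<alpha>)
    then show ?thesis using fwd that by simp
  next
    case (Bwd \<alpha>)
    then have \<alpha>: "\<alpha> \<in> Mor C" using that by simp
    have w: "is_word C (rng C \<alpha>) [Fwd \<alpha>] (src C \<alpha>)" using \<alpha> C.src_closed by simp
    have "is_inverse H (on_mor K (zclass C (rng C \<alpha>, [Fwd \<alpha>], src C \<alpha>)))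
        (on_mor K (zclass C (src C \<alpha>, [Bwd \<alpha>], rng C \<alpha>)))"
      by (rule functor_inverse[OF K]) (use C.fund_is_inverse[OF w] w in \<open>auto simp: fund_Mor zpaths_def\<close>)
    then have "gpd_inv H (on_mor F \<alpha>) = on_mor K (zclass C (src C \<alpha>, [Bwd \<alpha>], rng C \<alpha>))"
      using H.gpd_inv_eq F \<alpha> fwd[OF \<alpha>] by (simp add: is_functor_def)
    then show ?thesis using Bwd by simp
  qed
  have "on_mor K (zclass C (u, w, v)) = val w v" if "is_word C u w v" for u w v
    using that
  proof (induction w arbitrary: u)
    case Nil
    then have "u \<in> Obj C" "u = v" by auto
    then show ?case using K obj[of u]
      by (simp add: is_functor_def val_Nil fund_Obj flip: fund_ident)
  next
    case (Cons a w)
    then have a: "letter_mor a \<in> Mor C" "letter_rng C a = u" and w: "is_word C (letter_src C a) w v"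
      by auto
    have wa: "is_word C u [a] (letter_src C a)" using a C.letter_closed by simp
    have "zclass C (u, a # w, v) =
        zclass C (u, [a], letter_src C a) \<cdot>\<^bsub>fund_groupoid C\<^esub> zclass C (letter_src C a, w, v)"
      using C.fund_comp[OF wa w] by simp
    moreover have "zclass C (u, [a], letter_src C a) \<in> Mor (fund_groupoid C)"
      "zclass C (letter_src C a, w, v) \<in> Mor (fund_groupoid C)"
      using wa w by (auto simp only: fund_Mor zpaths_def intro!: imageI)
    ultimately have "on_mor K (zclass C (u, a # w, v)) =
        on_mor K (zclass C (u, [a], letter_src C a)) \<cdot>\<^bsub>H\<^esub> on_mor K (zclass C (letter_src C a, w, v))"
      using K by (simp add: is_functor_def fund_src fund_rng)
    then show ?case using letter[OF a(1)] a Cons.IH[OF w] by (simp add: val_Cons)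
  qed
  then show ?thesis
    using obj by (auto simp: feq_on_def fund_Obj fund_Mor zpaths_def lift_zclass) (simp add: fund_lift_def)
qed

end

theorem fund_groupoid_universal:
  assumes "category C"
  shows "groupoid (fund_groupoid C)"
    and "Obj (fund_groupoid C) = Obj C"
    and "is_functor C (fund_groupoid C) (fund_incl C)"
    and "on_obj (fund_incl C) u = u"
    and "\<lbrakk>groupoid H; is_functor C H F\<rbrakk> \<Longrightarrow>
      is_functor (fund_groupoid C) H (fund_lift H F) \<and>
      feq_on C (fcomp (fund_lift H F) (fund_incl C)) F \<and>
      (\<forall>K. is_functor (fund_groupoid C) H K \<and> feq_on C (fcomp K (fund_incl C)) F \<longrightarrow>
         feq_on (fund_groupoid C) K (fund_lift H F))"
proof -
  interpret category C by fact
  show "groupoid (fund_groupoid C)" by (rule fund_groupoid_groupoid)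
  show "Obj (fund_groupoid C) = Obj C" by (rule fund_Obj)
  show "is_functor C (fund_groupoid C) (fund_incl C)" by (rule fund_incl_functor)
  show "on_obj (fund_incl C) u = u" by (simp add: fund_incl_def)
  assume "groupoid H" "is_functor C H F"
  then interpret fund_target C H F
    by (intro fund_target.intro fund_target_axioms.intro assms)
  show "is_functor (fund_groupoid C) H (fund_lift H F) \<and>
      feq_on C (fcomp (fund_lift H F) (fund_incl C)) F \<and>
      (\<forall>K. is_functor (fund_groupoid C) H K \<and> feq_on C (fcomp K (fund_incl C)) F \<longrightarrow>
         feq_on (fund_groupoid C) K (fund_lift H F))"
    using lift_functor lift_factors lift_unique by blast
qed

end

theory Submission
  imports Defs
begin

text \<open>
  Unique path lifting makes the fundamental groupoid of \<open>\<Lambda>\<close> act from the right on the vertices of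
  \<open>\<Omega>\<close>: \<open>u g\<close> is the source of the lift of \<open>g\<close> with range \<open>u\<close>. Then \<open>p\<^sub>* \<pi>(\<Omega>, v)\<close> is the stabilizer
  of \<open>v\<close>, deck morphisms are equivariant and are determined by their value at one vertex, and one
  with \<open>v \<mapsto> u\<close> exists iff the stabilizer of \<open>v\<close> fixes \<open>u\<close>. Since the stabilizer of \<open>v g\<close> is conjugate
  by \<open>g\<close> to that of \<open>v\<close>, normality amounts to transitivity on the fibre of \<open>x\<close>. Transitivity on one
  fibre gives it on all of them, by transport along paths, and this says that the orbits are the
  fibres of \<open>p\<close>, so that the quotient by the deck group is \<open>\<Lambda>\<close>.
\<close>

section \<open>Words and the fundamental group\<close>

lemma is_word_source_unique: "is_word C u w v \<Longrightarrow> is_word C u w v' \<Longrightarrow> v = v'"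
  by (induction w arbitrary: u) auto

lemma letter_inv_map: "letter_inv (map_letter f a) = map_letter f (letter_inv a)"
  by (cases a) auto

lemma functor_letter:
  assumes "is_functor C D F" "letter_mor a \<in> Mor C"
  shows "letter_mor (map_letter (on_mor F) a) \<in> Mor D"
    "letter_rng D (map_letter (on_mor F) a) = on_obj F (letter_rng C a)"
    "letter_src D (map_letter (on_mor F) a) = on_obj F (letter_src C a)"
  using assms by (cases a; auto simp: is_functor_def)+

lemma functor_word:
  assumes F: "is_functor C D F"
  shows "is_word C u w v \<Longrightarrow> is_word D (on_obj F u) (map (map_letter (on_mor F)) w) (on_obj F v)"
proof (induction w arbitrary: u)
  case Nil
  then show ?case using F by (auto simp: is_functor_def)
qed (auto simp: functor_letter[OF F])

text \<open>\<open>induced_map\<close> comes from the universal property; this makes it computable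
  on words. A backward letter is sent to the inverse of a class, which is the class of the backward
  letter by \<open>fund_is_inverse\<close> and uniqueness of inverses.\<close>

lemma induced_map_zclass:
  assumes F: "is_functor C D F" and w: "is_word C u w v"
  shows "induced_map D F (zclass C (u, w, v)) =
    zclass D (on_obj F u, map (map_letter (on_mor F)) w, on_obj F v)"
proof -
  interpret C: category C using F by (simp add: is_functor_def)
  interpret D: category D using F by (simp add: is_functor_def)
  interpret G: groupoid "fund_groupoid D" by (rule D.fund_groupoid_groupoid)
  have "is_functor C (fund_groupoid D) (fcomp (fund_incl D) F)"
    using F D.fund_incl_functor by (auto simp: is_functor_def fcomp_def)
  then interpret T: fund_target C "fund_groupoid D" "fcomp (fund_incl D) F"
    by unfold_locales
  have letter: "letter_value (fund_groupoid D) (fcomp (fund_incl D) F) a =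
      zclass D (on_obj F (letter_rng C a), [map_letter (on_mor F) a], on_obj F (letter_src C a))"
    if a: "letter_mor a \<in> Mor C" for a
  proof (cases a)
    case (Fwd \<alpha>)
    then show ?thesis using F a by (simp add: fcomp_def fund_incl_def is_functor_def)
  next
    case (Bwd \<alpha>)
    then have "is_word D (on_obj F (rng C \<alpha>)) [Fwd (on_mor F \<alpha>)] (on_obj F (src C \<alpha>))"
      using F a by (auto simp: is_functor_def C.src_closed)
    from D.fund_is_inverse[OF this] this show ?thesis
      using G.gpd_inv_eq Bwd F a
      by (auto simp: fcomp_def fund_incl_def is_functor_def fund_Mor zpaths_def)
  qed
  have "T.val w v = zclass D (on_obj F u, map (map_letter (on_mor F)) w, on_obj F v)"
    using w
  proof (induction w arbitrary: u)
    case Nil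
    then show ?case by (simp add: path_value.simps fund_ident fcomp_def fund_incl_def)
  next
    case (Cons a w)
    then have a: "letter_mor a \<in> Mor C" "letter_rng C a = u"
      and w: "is_word C (letter_src C a) w v" by auto
    have "is_word C u [a] (letter_src C a)" using a C.letter_closed by simp
    then have "is_word D (on_obj F u) [map_letter (on_mor F) a] (on_obj F (letter_src C a))"
      using functor_word[OF F] by fastforce
    from D.fund_comp[OF this functor_word[OF F w]] show ?case
      using a Cons.IH[OF w] by (simp add: T.val_Cons letter)
  qed
  then show ?thesis by (simp add: induced_map_def T.lift_zclass)
qed

section \<open>Loops, the fundamental group and connecting words\<close>

context category
begin

lemma fund_group_carrier:
  "carrier (fund_group C x) = {zclass C (x, w, x) | w. is_word C x w x}"
  by (auto simp: fund_group_def hom_set_def fund_Mor fund_src fund_rng zpaths_def)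

lemma fund_group_mult:
  "\<lbrakk>is_word C x w x; is_word C x w' x\<rbrakk> \<Longrightarrow>
    zclass C (x, w, x) \<otimes>\<^bsub>fund_group C x\<^esub> zclass C (x, w', x) = zclass C (x, w @ w', x)"
  by (simp add: fund_group_def fund_comp)

lemma fund_group_one: "\<one>\<^bsub>fund_group C x\<^esub> = zclass C (x, [], x)"
  by (simp add: fund_group_def fund_ident)

lemma fund_group_group:
  assumes x: "x \<in> Obj C"
  shows "group (fund_group C x)"
proof (rule groupI)
  fix g assume "g \<in> carrier (fund_group C x)"
  then obtain w where w: "g = zclass C (x, w, x)" "is_word C x w x"
    by (auto simp: fund_group_carrier)
  show "\<one>\<^bsub>fund_group C x\<^esub> \<otimes>\<^bsub>fund_group C x\<^esub> g = g"
    using fund_group_mult[of x "[]" w] w x by (simp add: fund_group_one)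
  show "\<exists>h\<in>carrier (fund_group C x). h \<otimes>\<^bsub>fund_group C x\<^esub> g = \<one>\<^bsub>fund_group C x\<^esub>"
    using fund_is_inverse[OF w(2)] is_word_inv[OF w(2)] w
    by (intro bexI[of _ "zclass C (x, rev (map letter_inv w), x)"])
      (auto simp: is_inverse_def fund_group_def fund_src fund_rng hom_set_def)
  fix h assume "h \<in> carrier (fund_group C x)"
  then obtain w' where w': "h = zclass C (x, w', x)" "is_word C x w' x"
    by (auto simp: fund_group_carrier)
  have ww': "is_word C x (w @ w') x" using w w' is_word_append by blast
  show "g \<otimes>\<^bsub>fund_group C x\<^esub> h \<in> carrier (fund_group C x)"
    using w w' ww' by (auto simp: fund_group_mult) (auto simp: fund_group_carrier)
  fix e assume "e \<in> carrier (fund_group C x)"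
  then obtain w'' where w'': "e = zclass C (x, w'', x)" "is_word C x w'' x"
    by (auto simp: fund_group_carrier)
  have "is_word C x (w' @ w'') x" using w' w'' is_word_append by blast
  then show "g \<otimes>\<^bsub>fund_group C x\<^esub> h \<otimes>\<^bsub>fund_group C x\<^esub> e =
      g \<otimes>\<^bsub>fund_group C x\<^esub> (h \<otimes>\<^bsub>fund_group C x\<^esub> e)"
    using w w' w'' ww' by (simp add: fund_group_mult)
next
  show "\<one>\<^bsub>fund_group C x\<^esub> \<in> carrier (fund_group C x)"
    using x by (auto simp: fund_group_one fund_group_carrier intro!: exI[of _ "[]"])
qed

text \<open>Each link in a chain of the generated equivalence relation supplies one letter,
  \<open>Fwd\<close> or \<open>Bwd\<close> according to its direction, and these letters
  concatenate.\<close>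

lemma connected_imp_word:
  assumes "connected_cat C" "u \<in> Obj C" "v \<in> Obj C"
  shows "\<exists>w. is_word C u w v"
proof -
  have "equivclp (\<lambda>a b. hom_set C a b \<noteq> {}) u v"
    using assms by (auto simp: connected_cat_def)
  then show ?thesis
    unfolding equivclp_def
  proof (induction rule: rtranclp_induct)
    case base
    then show ?case using assms(2) by (intro exI[of _ "[]"]) simp
  next
    case (step y z)
    then obtain w where w: "is_word C u w y" by blast
    from step.hyps(2) obtain a where "is_word C y [a] z"
    proof (cases rule: symclpE)
      case base
      then obtain \<alpha> where "\<alpha> \<in> Mor C" "rng C \<alpha> = y" "src C \<alpha> = z" by (auto simp: hom_set_def)
      then show ?thesis using that[of "Fwd \<alpha>"] by (auto simp: src_closed)
    next
      case sym
      then obtain \<alpha> where "\<alpha> \<in> Mor C" "rng C \<alpha> = z" "src C \<alpha> = y" by (auto simp: hom_set_def)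
      then show ?thesis using that[of "Bwd \<alpha>"] by (auto simp: rng_closed)
    qed
    with w show ?case using is_word_append by blast
  qed
qed

end

lemma kgraph_morphism_fcomp:
  "kgraph_morphism A B F \<Longrightarrow> kgraph_morphism B C G \<Longrightarrow> kgraph_morphism A C (fcomp G F)"
  by (auto simp: kgraph_morphism_def is_functor_def fcomp_def)

text \<open>Values off the domain category are arbitrary. This allows exchanging a deck morphism for
  its extensional restriction, and a map out of the quotient for the induced one.\<close>

lemma kgraph_morphism_cong:
  assumes "kgraph_morphism A B F" "feq_on A F G"
  shows "kgraph_morphism A B G"
proof -
  interpret A: category A using assms by (simp add: kgraph_morphism_def is_functor_def)
  show ?thesis
    using assms A.src_closed A.rng_closed A.ident_closed A.comp_closed
    by (simp add: kgraph_morphism_def is_functor_def feq_on_def)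
qed

section \<open>The action of the fundamental groupoid on the vertices\<close>

lemma map_letter_eq:
  "map_letter f a = Fwd y \<longleftrightarrow> (\<exists>z. a = Fwd z \<and> f z = y)"
  "map_letter f a = Bwd y \<longleftrightarrow> (\<exists>z. a = Bwd z \<and> f z = y)"
  by (cases a; simp)+

locale kgraph_covering =
  fixes k :: nat
    and \<Omega> :: "('o1, 'm1) kgraph"
    and \<Lambda> :: "('o2, 'm2) kgraph"
    and p :: "('o1, 'm1, 'o2, 'm2) fmap"
  assumes covering: "covering k \<Omega> \<Lambda> p"
begin

abbreviation po where "po \<equiv> on_obj p"
abbreviation pm where "pm \<equiv> on_mor p"

lemma morphism: "kgraph_morphism \<Omega> \<Lambda> p"
  using covering by (simp add: covering_def)

lemma p_functor: "is_functor \<Omega> \<Lambda> p"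
  using morphism by (simp add: kgraph_morphism_def)

sublocale \<Omega>: category \<Omega>
  using p_functor by (simp add: is_functor_def)

sublocale \<Lambda>: category \<Lambda>
  using p_functor by (simp add: is_functor_def)

lemma po_closed: "u \<in> Obj \<Omega> \<Longrightarrow> po u \<in> Obj \<Lambda>"
  and pm_closed: "\<alpha> \<in> Mor \<Omega> \<Longrightarrow> pm \<alpha> \<in> Mor \<Lambda>"
  and src_pm: "\<alpha> \<in> Mor \<Omega> \<Longrightarrow> src \<Lambda> (pm \<alpha>) = po (src \<Omega> \<alpha>)"
  and rng_pm: "\<alpha> \<in> Mor \<Omega> \<Longrightarrow> rng \<Lambda> (pm \<alpha>) = po (rng \<Omega> \<alpha>)"
  and pm_ident: "u \<in> Obj \<Omega> \<Longrightarrow> pm (ident \<Omega> u) = ident \<Lambda> (po u)"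
  and pm_comp: "\<lbrakk>\<alpha> \<in> Mor \<Omega>; \<beta> \<in> Mor \<Omega>; src \<Omega> \<alpha> = rng \<Omega> \<beta>\<rbrakk> \<Longrightarrow>
    pm (\<alpha> \<cdot>\<^bsub>\<Omega>\<^esub> \<beta>) = pm \<alpha> \<cdot>\<^bsub>\<Lambda>\<^esub> pm \<beta>"
  using p_functor by (simp_all add: is_functor_def)

lemma deg_pm: "\<alpha> \<in> Mor \<Omega> \<Longrightarrow> deg \<Lambda> (pm \<alpha>) = deg \<Omega> \<alpha>"
  using morphism by (simp add: kgraph_morphism_def)

lemma po_image: "po ` Obj \<Omega> = Obj \<Lambda>"
  and pm_image: "pm ` Mor \<Omega> = Mor \<Lambda>"
  using covering by (simp_all add: covering_def)

lemma bij_src: "u \<in> Obj \<Omega> \<Longrightarrow>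
    bij_betw pm {\<alpha> \<in> Mor \<Omega>. src \<Omega> \<alpha> = u} {\<mu> \<in> Mor \<Lambda>. src \<Lambda> \<mu> = po u}"
  and bij_rng: "u \<in> Obj \<Omega> \<Longrightarrow>
    bij_betw pm {\<alpha> \<in> Mor \<Omega>. rng \<Omega> \<alpha> = u} {\<mu> \<in> Mor \<Lambda>. rng \<Lambda> \<mu> = po u}"
  using covering by (auto simp: covering_def)

section \<open>Unique lifting of morphisms and words\<close>

lemma pm_eq_src:
  assumes "\<alpha> \<in> Mor \<Omega>" "\<beta> \<in> Mor \<Omega>" "src \<Omega> \<alpha> = src \<Omega> \<beta>" "pm \<alpha> = pm \<beta>"
  shows "\<alpha> = \<beta>"
  using bij_src[of "src \<Omega> \<alpha>"] assms \<Omega>.src_closed by (auto simp: bij_betw_def inj_on_def)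

lemma pm_eq_rng:
  assumes "\<alpha> \<in> Mor \<Omega>" "\<beta> \<in> Mor \<Omega>" "rng \<Omega> \<alpha> = rng \<Omega> \<beta>" "pm \<alpha> = pm \<beta>"
  shows "\<alpha> = \<beta>"
  using bij_rng[of "rng \<Omega> \<alpha>"] assms \<Omega>.rng_closed by (auto simp: bij_betw_def inj_on_def)

lemma ex_lift_src:
  assumes "u \<in> Obj \<Omega>" "\<mu> \<in> Mor \<Lambda>" "src \<Lambda> \<mu> = po u"
  obtains \<alpha> where "\<alpha> \<in> Mor \<Omega>" "src \<Omega> \<alpha> = u" "pm \<alpha> = \<mu>"
proof -
  have "\<mu> \<in> pm ` {\<alpha> \<in> Mor \<Omega>. src \<Omega> \<alpha> = u}"
    using bij_src[OF assms(1)] assms by (simp add: bij_betw_def)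
  then show ?thesis using that by blast
qed

lemma ex_lift_rng:
  assumes "u \<in> Obj \<Omega>" "\<mu> \<in> Mor \<Lambda>" "rng \<Lambda> \<mu> = po u"
  obtains \<alpha> where "\<alpha> \<in> Mor \<Omega>" "rng \<Omega> \<alpha> = u" "pm \<alpha> = \<mu>"
proof -
  have "\<mu> \<in> pm ` {\<alpha> \<in> Mor \<Omega>. rng \<Omega> \<alpha> = u}"
    using bij_rng[OF assms(1)] assms by (simp add: bij_betw_def)
  then show ?thesis using that by blast
qed

text \<open>Prescribing the range of a backward letter means prescribing the source of its morphism.
  So bijectivity of the covering at sources is used here alongside bijectivity at ranges.\<close>

lemma ex_lift_letter:
  assumes "u \<in> Obj \<Omega>" "letter_mor a \<in> Mor \<Lambda>" "letter_rng \<Lambda> a = po u"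
  obtains b where "letter_mor b \<in> Mor \<Omega>" "letter_rng \<Omega> b = u" "map_letter pm b = a"
proof (cases a)
  case (Fwd \<alpha>)
  then obtain \<beta> where "\<beta> \<in> Mor \<Omega>" "rng \<Omega> \<beta> = u" "pm \<beta> = \<alpha>"
    using ex_lift_rng[of u \<alpha>] assms by auto
  then show ?thesis using that[of "Fwd \<beta>"] Fwd by simp
next
  case (Bwd \<alpha>)
  then obtain \<beta> where "\<beta> \<in> Mor \<Omega>" "src \<Omega> \<beta> = u" "pm \<beta> = \<alpha>"
    using ex_lift_src[of u \<alpha>] assms by auto
  then show ?thesis using that[of "Bwd \<beta>"] Bwd by simp
qed

lemma letter_eq:
  assumes "letter_mor a \<in> Mor \<Omega>" "letter_mor b \<in> Mor \<Omega>" "letter_rng \<Omega> a = letter_rng \<Omega> b"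
    "map_letter pm a = map_letter pm b"
  shows "a = b"
  using assms by (cases a; cases b) (auto intro: pm_eq_src pm_eq_rng)

text \<open>First letters with common range and common image coincide by \<open>letter_eq\<close>;
  the remaining words then start at the same vertex.\<close>

lemma word_lift_unique:
  assumes "is_word \<Omega> u w v" "is_word \<Omega> u w' v'" "map (map_letter pm) w = map (map_letter pm) w'"
  shows "w = w'"
  using assms
proof (induction w arbitrary: u w')
  case (Cons a w)
  then obtain b w2 where w': "w' = b # w2" by (cases w') auto
  then have "a = b" using Cons.prems by (intro letter_eq) auto
  with Cons w' show ?case by auto
qed simp

lemma ex_word_lift:
  assumes "u \<in> Obj \<Omega>" "is_word \<Lambda> (po u) w y"
  shows "\<exists>w' v. is_word \<Omega> u w' v \<and> map (map_letter pm) w' = w"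
  using assms
proof (induction w arbitrary: u)
  case Nil
  then show ?case by (intro exI[of _ "[]"]) auto
next
  case (Cons a w)
  then obtain b where b: "letter_mor b \<in> Mor \<Omega>" "letter_rng \<Omega> b = u" "map_letter pm b = a"
    using ex_lift_letter[of u a] by auto
  have "letter_src \<Lambda> a = po (letter_src \<Omega> b)"
    using functor_letter(3)[OF p_functor b(1)] b by simp
  then obtain w' v where "is_word \<Omega> (letter_src \<Omega> b) w' v" "map (map_letter pm) w' = w"
    using Cons.IH[of "letter_src \<Omega> b"] Cons.prems \<Omega>.letter_closed[OF b(1)] by auto
  then show ?case using b by (intro exI[of _ "b # w'"] exI[of _ v]) auto
qed

text \<open>A relation instead of a function: existence and uniqueness of the endpoint are separate
  lemmas, and no default value is needed when the range of the path does not lie below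
  \<open>u\<close>.\<close>

definition path_lifts :: "'o1 \<Rightarrow> ('o2, 'm2) zpath \<Rightarrow> 'o1 \<Rightarrow> bool" where
  "path_lifts u P v \<longleftrightarrow> (\<exists>w. is_word \<Omega> u w v \<and> P = (po u, map (map_letter pm) w, po v))"

lemma path_lifts_unique:
  assumes "path_lifts u P v" "path_lifts u P v'"
  shows "v = v'"
proof -
  obtain w w' where w: "is_word \<Omega> u w v" "P = (po u, map (map_letter pm) w, po v)"
    and w': "is_word \<Omega> u w' v'" "P = (po u, map (map_letter pm) w', po v')"
    using assms by (auto simp: path_lifts_def)
  then have "w = w'" by (intro word_lift_unique[OF w(1) w'(1)]) simp
  with w w' show ?thesis by (simp add: is_word_source_unique)
qed

lemma ex_path_lift:
  assumes "u \<in> Obj \<Omega>" "P \<in> zpaths \<Lambda>" "fst P = po u"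
  shows "\<exists>v. path_lifts u P v"
proof -
  obtain w y where P: "P = (po u, w, y)" "is_word \<Lambda> (po u) w y"
    using assms by (cases P) (auto simp: zpaths_def)
  then obtain w' v where w': "is_word \<Omega> u w' v" "map (map_letter pm) w' = w"
    using ex_word_lift assms(1) by blast
  then have "y = po v"
    using functor_word[OF p_functor w'(1)] P is_word_source_unique by metis
  then show ?thesis using w' P by (auto simp: path_lifts_def)
qed

text \<open>A composite lifts to the composite of the lifts. A lift of an identity is an identity,
  both having the same range and image. In a cancelling pair the two lifted morphisms have the same
  image and share a source or a range, so they are equal and cancel upstairs as well.\<close>

lemma word_rel_lift:
  assumes "word_rel \<Lambda> (map (map_letter pm) l) r" "is_word \<Omega> s l t"
  shows "\<exists>r'. is_word \<Omega> s r' t \<and> map (map_letter pm) r' = r"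
  using assms(1)
proof cases
  case (compose \<alpha> \<beta>)
  then obtain \<alpha>' \<beta>' where l: "l = [Fwd \<alpha>', Fwd \<beta>']" "pm \<alpha>' = \<alpha>" "pm \<beta>' = \<beta>"
    by (auto simp: map_eq_Cons_conv map_letter_eq)
  then show ?thesis using assms(2) compose
    by (intro exI[of _ "[Fwd (\<alpha>' \<cdot>\<^bsub>\<Omega>\<^esub> \<beta>')]"])
      (auto simp: \<Omega>.comp_closed \<Omega>.src_comp \<Omega>.rng_comp pm_comp)
next
  case (ident y)
  then obtain \<epsilon> where l: "l = [Fwd \<epsilon>]" "pm \<epsilon> = ident \<Lambda> y"
    by (auto simp: map_eq_Cons_conv map_letter_eq)
  then have s: "\<epsilon> \<in> Mor \<Omega>" "rng \<Omega> \<epsilon> = s" "src \<Omega> \<epsilon> = t" "s \<in> Obj \<Omega>"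
    using assms(2) \<Omega>.rng_closed by auto
  then have "po s = y" using rng_pm[of \<epsilon>] l(2) ident \<Lambda>.rng_ident by simp
  then have "\<epsilon> = ident \<Omega> s"
    using s l by (intro pm_eq_rng) (auto simp: \<Omega>.ident_closed \<Omega>.rng_ident pm_ident)
  then show ?thesis using s ident by (intro exI[of _ "[]"]) (auto simp: \<Omega>.src_ident)
next
  case (cancel_right \<alpha>)
  then obtain \<alpha>' \<beta>' where l: "l = [Fwd \<alpha>', Bwd \<beta>']" "pm \<alpha>' = \<alpha>" "pm \<beta>' = \<alpha>"
    by (auto simp: map_eq_Cons_conv map_letter_eq)
  then have "\<alpha>' = \<beta>'" using assms(2) by (intro pm_eq_src) auto
  then show ?thesis using assms(2) l cancel_right by (intro exI[of _ "[]"]) auto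
next
  case (cancel_left \<alpha>)
  then obtain \<alpha>' \<beta>' where l: "l = [Bwd \<alpha>', Fwd \<beta>']" "pm \<alpha>' = \<alpha>" "pm \<beta>' = \<alpha>"
    by (auto simp: map_eq_Cons_conv map_letter_eq)
  then have "\<alpha>' = \<beta>'" using assms(2) by (intro pm_eq_rng) auto
  then show ?thesis using assms(2) l cancel_left by (intro exI[of _ "[]"]) auto
qed

lemma path_lifts_zstep_forward:
  assumes "zstep \<Lambda> P Q" "path_lifts u P v"
  shows "path_lifts u Q v"
  using assms(1)
proof cases
  case (zstep l r x a b y)
  obtain w where w: "is_word \<Omega> u w v" "P = (po u, map (map_letter pm) w, po v)"
    using assms(2) by (auto simp: path_lifts_def)
  then have "map (map_letter pm) w = a @ l @ b" using zstep(1) by simp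
  then obtain a' c where a': "w = a' @ c" "map (map_letter pm) a' = a" "map (map_letter pm) c = l @ b"
    using map_eq_append_conv by metis
  then obtain l' b' where "c = l' @ b'" "map (map_letter pm) l' = l" "map (map_letter pm) b' = b"
    using map_eq_append_conv by metis
  note eq = a'(1)[unfolded this(1)] a'(2) this(2,3)
  then obtain s t where *: "is_word \<Omega> u a' s" "is_word \<Omega> s l' t" "is_word \<Omega> t b' v"
    using w(1) unfolding eq \<Omega>.is_word_append by blast
  then obtain r' where "is_word \<Omega> s r' t" "map (map_letter pm) r' = r"
    using word_rel_lift zstep(3) eq by blast
  then have "is_word \<Omega> u (a' @ r' @ b') v" "Q = (po u, map (map_letter pm) (a' @ r' @ b'), po v)"
    using * eq w zstep by (auto simp: \<Omega>.is_word_append)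
  then show ?thesis unfolding path_lifts_def by blast
qed

text \<open>Read backwards, a step inserts letters, which would have to be lifted anew. Instead
  \<open>P\<close> receives some lift from \<open>u\<close>; pushing it forward to \<open>Q\<close>
  and applying uniqueness there identifies its endpoint.\<close>

lemma path_lifts_zstep:
  assumes "zstep \<Lambda> P Q"
  shows "path_lifts u P v \<longleftrightarrow> path_lifts u Q v"
proof
  show "path_lifts u P v \<Longrightarrow> path_lifts u Q v" by (rule path_lifts_zstep_forward[OF assms])
  assume Q: "path_lifts u Q v"
  then have "u \<in> Obj \<Omega>" "fst P = po u"
    using zstep_ends[OF assms] \<Omega>.is_word_Obj by (auto simp: path_lifts_def)
  then obtain v' where v': "path_lifts u P v'"
    using ex_path_lift zstep_paths[OF assms] by blast
  with Q have "v' = v" using path_lifts_zstep_forward[OF assms] path_lifts_unique by blast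
  with v' show "path_lifts u P v" by simp
qed

text \<open>
  \<open>lifts u g v\<close>: the lift with range \<open>u\<close> of the element \<open>g\<close> of the fundamental groupoid has
  source \<open>v\<close>, that is, \<open>u g = v\<close> for the right action of the groupoid on the vertices.
\<close>

definition lifts :: "'o1 \<Rightarrow> ('o2, 'm2) zpath set \<Rightarrow> 'o1 \<Rightarrow> bool" where
  "lifts u g v \<longleftrightarrow> (\<exists>w. is_word \<Omega> u w v \<and> g = zclass \<Lambda> (po u, map (map_letter pm) w, po v))"

lemma lifts_word: "is_word \<Omega> u w v \<Longrightarrow> lifts u (zclass \<Lambda> (po u, map (map_letter pm) w, po v)) v"
  by (auto simp: lifts_def)

text \<open>Two paths representing \<open>g\<close> are joined by elementary steps in either
  direction, and having a lift from \<open>u\<close> to \<open>v\<close> is invariant under each of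
  them. Uniqueness thus reduces to that for a single path.\<close>

lemma lifts_unique:
  assumes "lifts u g v" "lifts u g v'"
  shows "v = v'"
proof -
  obtain P Q where P: "path_lifts u P v" "g = zclass \<Lambda> P" and Q: "path_lifts u Q v'" "g = zclass \<Lambda> Q"
    using assms unfolding lifts_def path_lifts_def by blast
  then have "equivclp (zstep \<Lambda>) P Q" using zclass_eq_iff by metis
  then have "path_lifts u P v = path_lifts u Q v"
    by (rule equivclp_invariant) (rule path_lifts_zstep)
  then show ?thesis using P Q path_lifts_unique by blast
qed

lemma lifts_closed:
  assumes "lifts u g v"
  shows "u \<in> Obj \<Omega>" "v \<in> Obj \<Omega>" "g \<in> Mor (fund_groupoid \<Lambda>)"
    "rng (fund_groupoid \<Lambda>) g = po u" "src (fund_groupoid \<Lambda>) g = po v"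
proof -
  obtain w where w: "is_word \<Omega> u w v" "g = zclass \<Lambda> (po u, map (map_letter pm) w, po v)"
    using assms by (auto simp: lifts_def)
  show "u \<in> Obj \<Omega>" "v \<in> Obj \<Omega>" using \<Omega>.is_word_Obj[OF w(1)] by auto
  show "g \<in> Mor (fund_groupoid \<Lambda>)" "rng (fund_groupoid \<Lambda>) g = po u" "src (fund_groupoid \<Lambda>) g = po v"
    using w functor_word[OF p_functor w(1)] by (auto simp: fund_Mor zpaths_def fund_rng fund_src)
qed

lemma ex_lifts:
  assumes "u \<in> Obj \<Omega>" "g \<in> Mor (fund_groupoid \<Lambda>)" "rng (fund_groupoid \<Lambda>) g = po u"
  shows "\<exists>v. lifts u g v"
proof -
  obtain P where P: "P \<in> zpaths \<Lambda>" "g = zclass \<Lambda> P" using assms by (auto simp: fund_Mor)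
  then have "fst P = po u" using assms by (cases P) (auto simp: fund_rng)
  then show ?thesis using ex_path_lift[OF assms(1) P(1)] P(2) by (auto simp: path_lifts_def lifts_def)
qed

lemma lifts_ident: "u \<in> Obj \<Omega> \<Longrightarrow> lifts u (ident (fund_groupoid \<Lambda>) (po u)) u"
  using lifts_word[of u "[]" u] by (simp add: fund_ident)

lemma lifts_comp:
  assumes "lifts u g t" "lifts t h v"
  shows "lifts u (g \<cdot>\<^bsub>fund_groupoid \<Lambda>\<^esub> h) v"
proof -
  obtain w w' where w: "is_word \<Omega> u w t" "g = zclass \<Lambda> (po u, map (map_letter pm) w, po t)"
    and w': "is_word \<Omega> t w' v" "h = zclass \<Lambda> (po t, map (map_letter pm) w', po v)"
    using assms by (auto simp: lifts_def)
  have "is_word \<Omega> u (w @ w') v" using w w' \<Omega>.is_word_append by blast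
  from lifts_word[OF this] show ?thesis
    using w w' \<Lambda>.fund_comp[OF functor_word[OF p_functor w(1)] functor_word[OF p_functor w'(1)]] by simp
qed

sublocale \<Pi>: groupoid "fund_groupoid \<Lambda>"
  by (rule \<Lambda>.fund_groupoid_groupoid)

text \<open>Inverting letters commutes with applying \<open>p\<close>, so the reversed lift is a
  lift of the reversed word, which represents the inverse class.\<close>

lemma lifts_inv:
  assumes "lifts u g v"
  shows "lifts v (gpd_inv (fund_groupoid \<Lambda>) g) u"
proof -
  obtain w where w: "is_word \<Omega> u w v" "g = zclass \<Lambda> (po u, map (map_letter pm) w, po v)"
    using assms by (auto simp: lifts_def)
  have "gpd_inv (fund_groupoid \<Lambda>) g = zclass \<Lambda> (po v, rev (map letter_inv (map (map_letter pm) w)), po u)"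
    using \<Pi>.gpd_inv_eq \<Lambda>.fund_is_inverse[OF functor_word[OF p_functor w(1)]] lifts_closed(3)[OF assms] w(2)
    by blast
  also have "rev (map letter_inv (map (map_letter pm) w)) = map (map_letter pm) (rev (map letter_inv w))"
    by (simp add: rev_map letter_inv_map)
  finally show ?thesis using lifts_word[OF \<Omega>.is_word_inv[OF w(1)]] by simp
qed

lemma lifts_edge:
  assumes "\<alpha> \<in> Mor \<Omega>"
  shows "lifts (rng \<Omega> \<alpha>) (on_mor (fund_incl \<Lambda>) (pm \<alpha>)) (src \<Omega> \<alpha>)"
  using lifts_word[of "rng \<Omega> \<alpha>" "[Fwd \<alpha>]" "src \<Omega> \<alpha>"] assms
  by (simp add: fund_incl_def rng_pm src_pm \<Omega>.src_closed)

text \<open>Condition (i) becomes a statement about a stabilizer: classes of projected loops at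
  \<open>v\<close> are precisely those whose lift from \<open>v\<close> closes up.\<close>

lemma image_fund_group:
  assumes "v \<in> Obj \<Omega>"
  shows "induced_map \<Lambda> p ` carrier (fund_group \<Omega> v) = {g. lifts v g v}"
proof -
  have "carrier (fund_group \<Omega> v) = (\<lambda>w. zclass \<Omega> (v, w, v)) ` {w. is_word \<Omega> v w v}"
    by (auto simp: \<Omega>.fund_group_carrier)
  then have "induced_map \<Lambda> p ` carrier (fund_group \<Omega> v) =
      (\<lambda>w. induced_map \<Lambda> p (zclass \<Omega> (v, w, v))) ` {w. is_word \<Omega> v w v}"
    by (simp only: image_image)
  also have "\<dots> = (\<lambda>w. zclass \<Lambda> (po v, map (map_letter pm) w, po v)) ` {w. is_word \<Omega> v w v}"
    by (intro image_cong refl) (simp add: induced_map_zclass[OF p_functor])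
  also have "\<dots> = {g. lifts v g v}" unfolding lifts_def by blast
  finally show ?thesis .
qed

text \<open>Not required to be invertible.\<close>

definition deck :: "('o1, 'm1, 'o1, 'm1) fmap \<Rightarrow> bool" where
  "deck \<phi> \<longleftrightarrow> kgraph_morphism \<Omega> \<Omega> \<phi> \<and> feq_on \<Omega> (fcomp p \<phi>) p"

lemma deckD:
  assumes "deck \<phi>"
  shows "u \<in> Obj \<Omega> \<Longrightarrow> on_obj \<phi> u \<in> Obj \<Omega>" "u \<in> Obj \<Omega> \<Longrightarrow> po (on_obj \<phi> u) = po u"
    "\<alpha> \<in> Mor \<Omega> \<Longrightarrow> on_mor \<phi> \<alpha> \<in> Mor \<Omega>" "\<alpha> \<in> Mor \<Omega> \<Longrightarrow> pm (on_mor \<phi> \<alpha>) = pm \<alpha>"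
    "\<alpha> \<in> Mor \<Omega> \<Longrightarrow> src \<Omega> (on_mor \<phi> \<alpha>) = on_obj \<phi> (src \<Omega> \<alpha>)"
    "\<alpha> \<in> Mor \<Omega> \<Longrightarrow> rng \<Omega> (on_mor \<phi> \<alpha>) = on_obj \<phi> (rng \<Omega> \<alpha>)"
  using assms by (simp_all add: deck_def kgraph_morphism_def is_functor_def feq_on_def fcomp_def)

lemma deck_fid: "deck fid"
  by (simp add: deck_def kgraph_morphism_def is_functor_def feq_on_def fcomp_def fid_def
      \<Omega>.category_axioms)

lemma deck_fcomp:
  assumes "deck \<phi>" "deck \<psi>"
  shows "deck (fcomp \<phi> \<psi>)"
proof -
  have "feq_on \<Omega> (fcomp p (fcomp \<phi> \<psi>)) p"
    by (simp add: feq_on_def fcomp_def deckD(1-4)[OF assms(1)] deckD(1-4)[OF assms(2)])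
  then show ?thesis
    using assms kgraph_morphism_fcomp unfolding deck_def by blast
qed

text \<open>Equivariance: since \<open>p\<close> absorbs \<phi>, the image under \<phi> of a lift of
  \<open>g\<close> is again a lift of \<open>g\<close>.\<close>

lemma deck_lifts:
  assumes \<phi>: "deck \<phi>" and g: "lifts u g v"
  shows "lifts (on_obj \<phi> u) g (on_obj \<phi> v)"
proof -
  obtain w where w: "is_word \<Omega> u w v" "g = zclass \<Lambda> (po u, map (map_letter pm) w, po v)"
    using g by (auto simp: lifts_def)
  have F: "is_functor \<Omega> \<Omega> \<phi>" using \<phi> by (simp add: deck_def kgraph_morphism_def)
  have proj: "map (map_letter pm) (map (map_letter (on_mor \<phi>)) w) = map (map_letter pm) w"
    using w(1)
  proof (induction w arbitrary: u)
    case (Cons a w)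
    then have "letter_mor a \<in> Mor \<Omega>" "is_word \<Omega> (letter_src \<Omega> a) w v" by auto
    moreover from this have "map_letter pm (map_letter (on_mor \<phi>) a) = map_letter pm a"
      using deckD(4)[OF \<phi>] by (cases a) auto
    ultimately show ?case using Cons.IH by (simp only: list.map)
  qed simp
  then show ?thesis
    using lifts_word[OF functor_word[OF F w(1)]] \<Omega>.is_word_Obj[OF w(1)]
    by (simp add: w(2) proj deckD(2)[OF \<phi>] del: map_map)
qed

text \<open>The vertex part of a deck morphism determines the rest, because its value on \<alpha>
  has a known range and a known image under \<open>p\<close>.\<close>

lemma deck_mor_eq:
  assumes "deck \<phi>" "\<alpha> \<in> Mor \<Omega>" "\<beta> \<in> Mor \<Omega>" "on_obj \<phi> (rng \<Omega> \<alpha>) = rng \<Omega> \<beta>" "pm \<alpha> = pm \<beta>"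
  shows "on_mor \<phi> \<alpha> = \<beta>"
  using assms deckD[OF assms(1)] by (intro pm_eq_rng) auto

end

section \<open>The group of deck transformations\<close>

context kgraph_covering
begin

text \<open>Elements of \<open>Aut\<close> are extensional; through this normalization, product and
  unit in \<open>Aut\<close> are the restrictions of \<open>fcomp\<close> and
  \<open>fid\<close>.\<close>

definition restrict_fmap :: "('o1, 'm1, 'o1, 'm1) fmap \<Rightarrow> ('o1, 'm1, 'o1, 'm1) fmap" where
  "restrict_fmap \<phi> = \<lparr>on_obj = restrict (on_obj \<phi>) (Obj \<Omega>), on_mor = restrict (on_mor \<phi>) (Mor \<Omega>)\<rparr>"

lemma restrict_fmap_simps [simp]:
  "u \<in> Obj \<Omega> \<Longrightarrow> on_obj (restrict_fmap \<phi>) u = on_obj \<phi> u"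
  "\<alpha> \<in> Mor \<Omega> \<Longrightarrow> on_mor (restrict_fmap \<phi>) \<alpha> = on_mor \<phi> \<alpha>"
  by (simp_all add: restrict_fmap_def)

lemma Aut_mult: "\<phi> \<otimes>\<^bsub>Aut \<Omega> p\<^esub> \<psi> = restrict_fmap (fcomp \<phi> \<psi>)"
  by (simp add: Aut_def restrict_fmap_def fcomp_def compose_def comp_def)

lemma Aut_one: "\<one>\<^bsub>Aut \<Omega> p\<^esub> = restrict_fmap fid"
  by (simp add: Aut_def restrict_fmap_def fid_def)

lemma Aut_deck: "\<phi> \<in> carrier (Aut \<Omega> p) \<Longrightarrow> deck \<phi>"
  by (simp add: Aut_def deck_def kgraph_iso_def)

lemma Aut_ext: "\<phi> \<in> carrier (Aut \<Omega> p) \<Longrightarrow> restrict_fmap \<phi> = \<phi>"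
  by (simp add: Aut_def restrict_fmap_def extensional_restrict)

text \<open>The inverse provided by \<open>kgraph_iso\<close> is not assumed to lie over the base.
  That it does follows by evaluating the compatibility of \<phi> with \<open>p\<close> at values of
  \<psi>.\<close>

lemma Aut_inverse:
  assumes "\<phi> \<in> carrier (Aut \<Omega> p)"
  obtains \<psi> where "deck \<psi>" "feq_on \<Omega> (fcomp \<psi> \<phi>) fid" "feq_on \<Omega> (fcomp \<phi> \<psi>) fid"
proof -
  obtain \<psi> where \<psi>: "kgraph_morphism \<Omega> \<Omega> \<psi>" "feq_on \<Omega> (fcomp \<psi> \<phi>) fid" "feq_on \<Omega> (fcomp \<phi> \<psi>) fid"
    using assms by (auto simp: Aut_def kgraph_iso_def)
  have "po (on_obj \<psi> u) = po u" if "u \<in> Obj \<Omega>" for u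
  proof -
    have "on_obj \<psi> u \<in> Obj \<Omega>" using \<psi>(1) that by (simp add: kgraph_morphism_def is_functor_def)
    moreover have "on_obj \<phi> (on_obj \<psi> u) = u" using \<psi>(3) that by (simp add: feq_on_def fcomp_def fid_def)
    ultimately show ?thesis using deckD(2)[OF Aut_deck[OF assms], of "on_obj \<psi> u"] by simp
  qed
  moreover have "pm (on_mor \<psi> \<alpha>) = pm \<alpha>" if "\<alpha> \<in> Mor \<Omega>" for \<alpha>
  proof -
    have "on_mor \<psi> \<alpha> \<in> Mor \<Omega>" using \<psi>(1) that by (simp add: kgraph_morphism_def is_functor_def)
    moreover have "on_mor \<phi> (on_mor \<psi> \<alpha>) = \<alpha>" using \<psi>(3) that by (simp add: feq_on_def fcomp_def fid_def)
    ultimately show ?thesis using deckD(4)[OF Aut_deck[OF assms], of "on_mor \<psi> \<alpha>"] by simp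
  qed
  ultimately have "deck \<psi>" using \<psi>(1) by (simp add: deck_def feq_on_def fcomp_def)
  with \<psi> show ?thesis using that by blast
qed

lemma restrict_fmap_Aut:
  assumes \<phi>: "deck \<phi>" and \<psi>: "deck \<psi>"
    and inv: "feq_on \<Omega> (fcomp \<psi> \<phi>) fid" "feq_on \<Omega> (fcomp \<phi> \<psi>) fid"
  shows "restrict_fmap \<phi> \<in> carrier (Aut \<Omega> p)"
proof -
  have eq: "feq_on \<Omega> \<phi> (restrict_fmap \<phi>)" by (simp add: feq_on_def)
  have "kgraph_morphism \<Omega> \<Omega> (restrict_fmap \<phi>)"
    using \<phi> eq kgraph_morphism_cong unfolding deck_def by blast
  moreover have "feq_on \<Omega> (fcomp p (restrict_fmap \<phi>)) p"
    using \<phi> unfolding deck_def by (simp add: feq_on_def fcomp_def)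
  moreover have "kgraph_morphism \<Omega> \<Omega> \<psi>" using \<psi> by (simp add: deck_def)
  moreover have "feq_on \<Omega> (fcomp \<psi> (restrict_fmap \<phi>)) fid" "feq_on \<Omega> (fcomp (restrict_fmap \<phi>) \<psi>) fid"
    using inv deckD(1,3)[OF \<psi>] by (simp_all add: feq_on_def fcomp_def)
  ultimately show ?thesis
    by (auto simp: Aut_def kgraph_iso_def restrict_fmap_def)
qed

lemma fmap_eqI:
  assumes "\<And>u. u \<in> Obj \<Omega> \<Longrightarrow> on_obj \<phi> u = on_obj \<psi> u" "\<And>\<alpha>. \<alpha> \<in> Mor \<Omega> \<Longrightarrow> on_mor \<phi> \<alpha> = on_mor \<psi> \<alpha>"
  shows "restrict_fmap \<phi> = restrict_fmap \<psi>"
  using assms by (auto simp: restrict_fmap_def intro!: restrict_ext)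

lemma Aut_group: "group (Aut \<Omega> p)"
proof (rule groupI)
  fix \<phi> assume \<phi>: "\<phi> \<in> carrier (Aut \<Omega> p)"
  note d\<phi> = deckD(1,3)[OF Aut_deck[OF \<phi>]]
  obtain \<psi> where \<psi>: "deck \<psi>" "feq_on \<Omega> (fcomp \<psi> \<phi>) fid" "feq_on \<Omega> (fcomp \<phi> \<psi>) fid"
    using Aut_inverse[OF \<phi>] .
  show "\<one>\<^bsub>Aut \<Omega> p\<^esub> \<otimes>\<^bsub>Aut \<Omega> p\<^esub> \<phi> = \<phi>"
    \<comment> \<open>Writing the right-hand \<phi> as its own restriction turns both sides into
      restrictions, which need to be compared on \<Omega> only.\<close>
    by (subst (2) Aut_ext[OF \<phi>, symmetric], unfold Aut_mult Aut_one, rule fmap_eqI)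
      (simp_all add: fcomp_def fid_def d\<phi>)
  have "restrict_fmap \<psi> \<in> carrier (Aut \<Omega> p)"
    using restrict_fmap_Aut[OF \<psi>(1) Aut_deck[OF \<phi>] \<psi>(3,2)] .
  moreover have "restrict_fmap \<psi> \<otimes>\<^bsub>Aut \<Omega> p\<^esub> \<phi> = \<one>\<^bsub>Aut \<Omega> p\<^esub>"
    unfolding Aut_mult Aut_one using \<psi>(2)
    by (intro fmap_eqI) (simp_all add: fcomp_def fid_def feq_on_def d\<phi>)
  ultimately show "\<exists>\<psi>\<in>carrier (Aut \<Omega> p). \<psi> \<otimes>\<^bsub>Aut \<Omega> p\<^esub> \<phi> = \<one>\<^bsub>Aut \<Omega> p\<^esub>" by blast
  fix \<phi>' assume \<phi>': "\<phi>' \<in> carrier (Aut \<Omega> p)"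
  note d\<phi>' = deckD(1,3)[OF Aut_deck[OF \<phi>']]
  obtain \<psi>' where \<psi>': "deck \<psi>'" "feq_on \<Omega> (fcomp \<psi>' \<phi>') fid" "feq_on \<Omega> (fcomp \<phi>' \<psi>') fid"
    using Aut_inverse[OF \<phi>'] .
  show "\<phi> \<otimes>\<^bsub>Aut \<Omega> p\<^esub> \<phi>' \<in> carrier (Aut \<Omega> p)"
    unfolding Aut_mult
  proof (rule restrict_fmap_Aut)
    show "deck (fcomp \<phi> \<phi>')" "deck (fcomp \<psi>' \<psi>)"
      using \<phi> \<phi>' \<psi> \<psi>' Aut_deck deck_fcomp by blast+
    show "feq_on \<Omega> (fcomp (fcomp \<psi>' \<psi>) (fcomp \<phi> \<phi>')) fid"
      using \<psi>(2) \<psi>'(2) by (simp add: fcomp_def fid_def feq_on_def d\<phi>')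
    show "feq_on \<Omega> (fcomp (fcomp \<phi> \<phi>') (fcomp \<psi>' \<psi>)) fid"
      using \<psi>(3) \<psi>'(3) by (simp add: fcomp_def fid_def feq_on_def deckD(1,3)[OF \<psi>(1)])
  qed
  fix \<chi> assume \<chi>: "\<chi> \<in> carrier (Aut \<Omega> p)"
  note d\<chi> = deckD(1,3)[OF Aut_deck[OF \<chi>]]
  show "\<phi> \<otimes>\<^bsub>Aut \<Omega> p\<^esub> \<phi>' \<otimes>\<^bsub>Aut \<Omega> p\<^esub> \<chi> = \<phi> \<otimes>\<^bsub>Aut \<Omega> p\<^esub> (\<phi>' \<otimes>\<^bsub>Aut \<Omega> p\<^esub> \<chi>)"
    unfolding Aut_mult by (rule fmap_eqI) (simp_all add: fcomp_def d\<chi> d\<phi>')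
next
  show "\<one>\<^bsub>Aut \<Omega> p\<^esub> \<in> carrier (Aut \<Omega> p)"
    unfolding Aut_one
    by (rule restrict_fmap_Aut[OF deck_fid deck_fid]) (simp_all add: feq_on_def fcomp_def fid_def)
qed

lemma Aut_fibre:
  assumes "\<phi> \<in> carrier (Aut \<Omega> p)" "a \<in> vertex_fibre \<Omega> p x"
  shows "on_obj \<phi> a \<in> vertex_fibre \<Omega> p x"
  using assms(2) deckD(1,2)[OF Aut_deck[OF assms(1)]] by (simp add: vertex_fibre_def)

text \<open>\<open>transitive_action\<close> in (ii) includes the axioms of a group action by
  extensional bijections. Establishing them here leaves only the existence of a group element
  joining two points, which is \<open>transitive_iff\<close>.\<close>

lemma Aut_action:
  "group_action (Aut \<Omega> p) (vertex_fibre \<Omega> p x) (\<lambda>\<phi>. restrict (on_obj \<phi>) (vertex_fibre \<Omega> p x))"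
proof -
  let ?E = "vertex_fibre \<Omega> p x"
  have Bij: "restrict (on_obj \<phi>) ?E \<in> Bij ?E" if \<phi>: "\<phi> \<in> carrier (Aut \<Omega> p)" for \<phi>
  proof -
    obtain \<psi> where \<psi>: "deck \<psi>" "feq_on \<Omega> (fcomp \<psi> \<phi>) fid" "feq_on \<Omega> (fcomp \<phi> \<psi>) fid"
      using Aut_inverse[OF \<phi>] .
    have "bij_betw (on_obj \<phi>) ?E ?E"
    proof (rule bij_betw_byWitness[where f' = "on_obj \<psi>"])
      show "\<forall>a\<in>?E. on_obj \<psi> (on_obj \<phi> a) = a" "\<forall>a\<in>?E. on_obj \<phi> (on_obj \<psi> a) = a"
        using \<psi> by (auto simp: feq_on_def fcomp_def fid_def vertex_fibre_def)
      show "on_obj \<phi> ` ?E \<subseteq> ?E" using Aut_fibre[OF \<phi>] by blast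
      show "on_obj \<psi> ` ?E \<subseteq> ?E" using deckD(1,2)[OF \<psi>(1)] by (auto simp: vertex_fibre_def)
    qed
    then show ?thesis by (simp add: Bij_def cong: bij_betw_cong)
  qed
  have "restrict (on_obj (\<phi> \<otimes>\<^bsub>Aut \<Omega> p\<^esub> \<psi>)) ?E =
      restrict (on_obj \<phi>) ?E \<otimes>\<^bsub>BijGroup ?E\<^esub> restrict (on_obj \<psi>) ?E"
    if "\<phi> \<in> carrier (Aut \<Omega> p)" "\<psi> \<in> carrier (Aut \<Omega> p)" for \<phi> \<psi>
  proof
    fix a
    show "restrict (on_obj (\<phi> \<otimes>\<^bsub>Aut \<Omega> p\<^esub> \<psi>)) ?E a =
        (restrict (on_obj \<phi>) ?E \<otimes>\<^bsub>BijGroup ?E\<^esub> restrict (on_obj \<psi>) ?E) a"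
    proof (cases "a \<in> ?E")
      case True
      then have "a \<in> Obj \<Omega>" by (simp add: vertex_fibre_def)
      then show ?thesis
        using True Aut_fibre[OF that(2) True] Bij[OF that(1)] Bij[OF that(2)]
        by (simp add: Aut_mult BijGroup_def compose_def fcomp_def)
    next
      case False
      then show ?thesis using Bij[OF that(1)] Bij[OF that(2)] by (simp add: BijGroup_def compose_def)
    qed
  qed
  then have "(\<lambda>\<phi>. restrict (on_obj \<phi>) ?E) \<in> hom (Aut \<Omega> p) (BijGroup ?E)"
    using Bij by (auto simp: hom_def BijGroup_def)
  then show ?thesis
    by (intro group_action.intro group_hom.intro group_hom_axioms.intro Aut_group group_BijGroup)
qed

lemma transitive_iff:
  "transitive_action (Aut \<Omega> p) (vertex_fibre \<Omega> p x) (\<lambda>\<phi>. restrict (on_obj \<phi>) (vertex_fibre \<Omega> p x))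
    \<longleftrightarrow> (\<forall>a\<in>vertex_fibre \<Omega> p x. \<forall>b\<in>vertex_fibre \<Omega> p x. \<exists>\<phi>\<in>carrier (Aut \<Omega> p). on_obj \<phi> a = b)"
  by (simp add: transitive_action_def transitive_action_axioms_def Aut_action Ball_def)

end

section \<open>Uniqueness and existence of deck transformations\<close>

locale connected_kgraph_covering = kgraph_covering +
  assumes connected: "connected_cat \<Omega>"
begin

lemma ex_lifts_between: "u \<in> Obj \<Omega> \<Longrightarrow> v \<in> Obj \<Omega> \<Longrightarrow> \<exists>g. lifts u g v"
  using \<Omega>.connected_imp_word[OF connected] lifts_word by blast

text \<open>By connectedness every vertex is the endpoint of a lift starting at \<open>v\<close>, so
  equivariance determines the vertex map from its value at \<open>v\<close>; unique lifting then
  determines the morphism map.\<close>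

lemma deck_unique:
  assumes \<phi>: "deck \<phi>" and \<psi>: "deck \<psi>" and v: "v \<in> Obj \<Omega>" "on_obj \<phi> v = on_obj \<psi> v"
  shows "feq_on \<Omega> \<phi> \<psi>"
proof -
  have obj: "on_obj \<phi> a = on_obj \<psi> a" if a: "a \<in> Obj \<Omega>" for a
  proof -
    obtain g where "lifts v g a" using ex_lifts_between v a by blast
    then have "lifts (on_obj \<phi> v) g (on_obj \<phi> a)" "lifts (on_obj \<psi> v) g (on_obj \<psi> a)"
      using deck_lifts \<phi> \<psi> by blast+
    then show ?thesis using v lifts_unique by simp
  qed
  have "on_mor \<phi> \<alpha> = on_mor \<psi> \<alpha>" if \<alpha>: "\<alpha> \<in> Mor \<Omega>" for \<alpha>
    using \<alpha> obj[OF \<Omega>.rng_closed[OF \<alpha>]] deckD[OF \<psi>] by (intro deck_mor_eq[OF \<phi>]) auto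
  with obj show ?thesis by (simp add: feq_on_def)
qed

text \<open>The deck morphism sends \<open>v g\<close> to \<open>u g\<close>, which only depends on \<open>v g\<close> by the stabilizer condition.\<close>

lemma ex_deck:
  assumes v: "v \<in> Obj \<Omega>" and u: "u \<in> Obj \<Omega>" and vu: "po v = po u"
    and stab: "\<And>g. lifts v g v \<Longrightarrow> lifts u g u"
  shows "\<exists>\<phi>. deck \<phi> \<and> on_obj \<phi> v = u"
proof -
  define f where "f a = (THE b. \<exists>g. lifts v g a \<and> lifts u g b)" for a
  have f_eq: "f a = b" if g: "lifts v g a" "lifts u g b" for g a b
  proof -
    have "b' = b" if h: "lifts v h a" "lifts u h b'" for h b'
    proof -
      let ?g = "gpd_inv (fund_groupoid \<Lambda>) g" and ?h = "gpd_inv (fund_groupoid \<Lambda>) h"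
      \<comment> \<open>If \<open>g\<close> and \<open>h\<close> both carry \<open>v\<close> to
        \<open>a\<close>, then \<open>g\<close> followed by the inverse of \<open>h\<close>
        stabilizes \<open>v\<close>, hence \<open>u\<close> by the hypothesis. This forces
        \<open>g\<close> and \<open>h\<close> to carry \<open>u\<close> to the same vertex.\<close>
      have "lifts v (g \<cdot>\<^bsub>fund_groupoid \<Lambda>\<^esub> ?h) v" using g h lifts_comp lifts_inv by blast
      then have "lifts u (g \<cdot>\<^bsub>fund_groupoid \<Lambda>\<^esub> ?h) u" by (rule stab)
      moreover obtain c where c: "lifts b ?h c"
        using ex_lifts[of b ?h] lifts_closed[OF g(1)] lifts_closed[OF g(2)] lifts_closed[OF lifts_inv[OF h(1)]]
        by auto
      ultimately have "c = u" using lifts_comp[OF g(2) c] lifts_unique by blast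
      then have "lifts b ?h u" using c by simp
      then have "lifts u (gpd_inv (fund_groupoid \<Lambda>) ?h) b" by (rule lifts_inv)
      moreover have "gpd_inv (fund_groupoid \<Lambda>) ?h = h"
      proof (rule \<Pi>.gpd_inv_eq)
        show "?h \<in> Mor (fund_groupoid \<Lambda>)" using lifts_closed[OF lifts_inv[OF h(1)]] by simp
        show "is_inverse (fund_groupoid \<Lambda>) ?h h"
          using \<Pi>.gpd_inv_is_inverse[OF lifts_closed(3)[OF h(1)]] lifts_closed(3)[OF h(1)]
          by (simp add: is_inverse_def)
      qed
      ultimately show ?thesis using h(2) lifts_unique by simp
    qed
    with g show ?thesis unfolding f_def by blast
  qed
  have f: "\<exists>g. lifts v g a \<and> lifts u g (f a)" if a: "a \<in> Obj \<Omega>" for a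
  proof -
    obtain g where g: "lifts v g a" using ex_lifts_between v a by blast
    then obtain b where "lifts u g b" using ex_lifts[OF u] lifts_closed[OF g] vu by metis
    with g f_eq show ?thesis by blast
  qed
  then have f_closed: "f a \<in> Obj \<Omega>" "po (f a) = po a" if "a \<in> Obj \<Omega>" for a
    using that lifts_closed by metis+
  \<comment> \<open>The only possible choice by unique lifting: the lift of
    \<open>pm \<alpha>\<close> whose range is the prescribed vertex.\<close>
  define m where "m \<alpha> = (THE \<beta>. \<beta> \<in> Mor \<Omega> \<and> rng \<Omega> \<beta> = f (rng \<Omega> \<alpha>) \<and> pm \<beta> = pm \<alpha>)" for \<alpha>
  have m_eq: "m \<alpha> = \<beta>" if "\<beta> \<in> Mor \<Omega>" "rng \<Omega> \<beta> = f (rng \<Omega> \<alpha>)" "pm \<beta> = pm \<alpha>" for \<alpha> \<beta>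
    unfolding m_def using that pm_eq_rng by (intro the_equality) auto
  have m: "m \<alpha> \<in> Mor \<Omega>" "rng \<Omega> (m \<alpha>) = f (rng \<Omega> \<alpha>)" "pm (m \<alpha>) = pm \<alpha>" if \<alpha>: "\<alpha> \<in> Mor \<Omega>" for \<alpha>
  proof -
    obtain \<beta> where \<beta>: "\<beta> \<in> Mor \<Omega>" "rng \<Omega> \<beta> = f (rng \<Omega> \<alpha>)" "pm \<beta> = pm \<alpha>"
      using ex_lift_rng[of "f (rng \<Omega> \<alpha>)" "pm \<alpha>"] \<alpha> f_closed[OF \<Omega>.rng_closed[OF \<alpha>]]
      by (auto simp: pm_closed rng_pm)
    then show "m \<alpha> \<in> Mor \<Omega>" "rng \<Omega> (m \<alpha>) = f (rng \<Omega> \<alpha>)" "pm (m \<alpha>) = pm \<alpha>"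
      using m_eq[OF \<beta>] by auto
  qed
  \<comment> \<open>Both \<alpha> and its image are lifts of one morphism of \<Lambda>, so appending
    its class to \<open>g\<close> moves the range to the source along each of them;
    \<open>f_eq\<close> then compares the sources.\<close>
  have m_src: "src \<Omega> (m \<alpha>) = f (src \<Omega> \<alpha>)" if \<alpha>: "\<alpha> \<in> Mor \<Omega>" for \<alpha>
  proof -
    obtain g where g: "lifts v g (rng \<Omega> \<alpha>)" "lifts u g (rng \<Omega> (m \<alpha>))"
      using f[OF \<Omega>.rng_closed[OF \<alpha>]] m(2)[OF \<alpha>] by auto
    show ?thesis
      using f_eq[OF lifts_comp[OF g(1) lifts_edge[OF \<alpha>]]] lifts_comp[OF g(2) lifts_edge[OF m(1)[OF \<alpha>]]]
        m(3)[OF \<alpha>] by simp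
  qed
  define \<phi> where "\<phi> = \<lparr>on_obj = f, on_mor = m\<rparr>"
  have "m (ident \<Omega> a) = ident \<Omega> (f a)" if "a \<in> Obj \<Omega>" for a
    using that f_closed by (intro m_eq) (auto simp: \<Omega>.ident_closed \<Omega>.rng_ident pm_ident)
  moreover have "m (\<alpha> \<cdot>\<^bsub>\<Omega>\<^esub> \<beta>) = m \<alpha> \<cdot>\<^bsub>\<Omega>\<^esub> m \<beta>"
    if "\<alpha> \<in> Mor \<Omega>" "\<beta> \<in> Mor \<Omega>" "src \<Omega> \<alpha> = rng \<Omega> \<beta>" for \<alpha> \<beta>
    using that m[of \<alpha>] m[of \<beta>] m_src[of \<alpha>]
    by (intro m_eq) (auto simp: \<Omega>.comp_closed \<Omega>.rng_comp pm_comp)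
  moreover have "deg \<Omega> (m \<alpha>) = deg \<Omega> \<alpha>" if "\<alpha> \<in> Mor \<Omega>" for \<alpha>
    using m[OF that] that deg_pm by metis
  ultimately have "kgraph_morphism \<Omega> \<Omega> \<phi>"
    using m m_src f_closed \<Omega>.category_axioms
    by (simp add: kgraph_morphism_def is_functor_def \<phi>_def)
  then have "deck \<phi>"
    using m f_closed by (simp add: deck_def feq_on_def fcomp_def \<phi>_def)
  moreover have "f v = u"
    using f_eq lifts_ident[OF v] lifts_ident[OF u] vu by simp
  ultimately show ?thesis by (auto simp: \<phi>_def)
qed

text \<open>Equality of the stabilizers gives deck morphisms in both directions. Their composites
  fix a vertex, so they are identities by \<open>deck_unique\<close>. A mere inclusion would only
  give the morphism of \<open>ex_deck\<close>.\<close>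

lemma ex_Aut:
  assumes v: "v \<in> Obj \<Omega>" and u: "u \<in> Obj \<Omega>" and vu: "po v = po u"
    and stab: "\<And>g. lifts v g v \<longleftrightarrow> lifts u g u"
  shows "\<exists>\<phi>\<in>carrier (Aut \<Omega> p). on_obj \<phi> v = u"
proof -
  obtain \<phi> where \<phi>: "deck \<phi>" "on_obj \<phi> v = u" using ex_deck[OF v u vu] stab by blast
  obtain \<psi> where \<psi>: "deck \<psi>" "on_obj \<psi> u = v" using ex_deck[OF u v vu[symmetric]] stab by blast
  have "feq_on \<Omega> (fcomp \<psi> \<phi>) fid" "feq_on \<Omega> (fcomp \<phi> \<psi>) fid"
    using deck_unique[OF deck_fcomp[OF \<psi>(1) \<phi>(1)] deck_fid v]
      deck_unique[OF deck_fcomp[OF \<phi>(1) \<psi>(1)] deck_fid u] \<phi>(2) \<psi>(2)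
    by (simp_all add: fcomp_def fid_def)
  then have "restrict_fmap \<phi> \<in> carrier (Aut \<Omega> p)" using restrict_fmap_Aut \<phi> \<psi> by blast
  then show ?thesis using \<phi>(2) v by (intro bexI[of _ "restrict_fmap \<phi>"]) auto
qed

end

section \<open>Normality, transitivity and the quotient\<close>

lemma the_elem_const:
  assumes "x \<in> A" "\<And>y. y \<in> A \<Longrightarrow> f y = c"
  shows "the_elem {f y | y. y \<in> A} = c"
proof -
  have "{f y | y. y \<in> A} = {c}" using assms by blast
  then show ?thesis by simp
qed

context kgraph_covering
begin

section \<open>Stabilizers inside the fundamental group\<close>

lemma lifts_left_unique: "lifts u g v \<Longrightarrow> lifts u' g v \<Longrightarrow> u = u'"
  using lifts_inv lifts_unique by blast

lemma fund_group_iff: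
  "g \<in> carrier (fund_group \<Lambda> x) \<longleftrightarrow>
    g \<in> Mor (fund_groupoid \<Lambda>) \<and> rng (fund_groupoid \<Lambda>) g = x \<and> src (fund_groupoid \<Lambda>) g = x"
  by (simp add: fund_group_def hom_set_def)

lemma fund_group_inv:
  assumes "x \<in> Obj \<Lambda>" "g \<in> carrier (fund_group \<Lambda> x)"
  shows "inv\<^bsub>fund_group \<Lambda> x\<^esub> g = gpd_inv (fund_groupoid \<Lambda>) g"
proof -
  have g: "g \<in> Mor (fund_groupoid \<Lambda>)" "rng (fund_groupoid \<Lambda>) g = x" "src (fund_groupoid \<Lambda>) g = x"
    using assms(2) by (simp_all add: fund_group_iff)
  note inv = \<Pi>.gpd_inv_is_inverse[OF g(1), unfolded is_inverse_def g(2,3)]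
  show ?thesis
  proof (rule group.inv_equality[OF \<Lambda>.fund_group_group[OF assms(1)] _ assms(2)])
    show "gpd_inv (fund_groupoid \<Lambda>) g \<otimes>\<^bsub>fund_group \<Lambda> x\<^esub> g = \<one>\<^bsub>fund_group \<Lambda> x\<^esub>"
      using inv by (simp add: fund_group_def)
    show "gpd_inv (fund_groupoid \<Lambda>) g \<in> carrier (fund_group \<Lambda> x)"
      using inv by (simp add: fund_group_iff)
  qed
qed

lemma lifts_mult:
  "lifts u g t \<Longrightarrow> lifts t h v \<Longrightarrow> lifts u (g \<otimes>\<^bsub>fund_group \<Lambda> x\<^esub> h) v"
  using lifts_comp by (simp add: fund_group_def)

text \<open>The conjugate runs from \<open>v\<close> to \<open>u\<close>, then along
  \<open>h\<close>, then back along the inverse of \<open>g\<close>; it closes up at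
  \<open>v\<close> exactly when its middle part closes up at \<open>u\<close>.\<close>

lemma lifts_conjugate:
  assumes g: "lifts v g u" "g \<in> carrier (fund_group \<Lambda> x)" and h: "h \<in> carrier (fund_group \<Lambda> x)"
  shows "lifts v (g \<otimes>\<^bsub>fund_group \<Lambda> x\<^esub> h \<otimes>\<^bsub>fund_group \<Lambda> x\<^esub> inv\<^bsub>fund_group \<Lambda> x\<^esub> g) v \<longleftrightarrow> lifts u h u"
proof -
  have x: "po v = x" "po u = x"
    using lifts_closed[OF g(1)] g(2) by (simp_all add: fund_group_iff)
  have xO: "x \<in> Obj \<Lambda>" using po_closed[OF lifts_closed(1)[OF g(1)]] x by simp
  let ?g = "inv\<^bsub>fund_group \<Lambda> x\<^esub> g"
  have inv: "lifts u ?g v" using fund_group_inv[OF xO g(2)] lifts_inv[OF g(1)] by simp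
  show ?thesis
  proof
    assume "lifts u h u"
    then show "lifts v (g \<otimes>\<^bsub>fund_group \<Lambda> x\<^esub> h \<otimes>\<^bsub>fund_group \<Lambda> x\<^esub> ?g) v"
      using g inv lifts_mult by blast
  next
    assume conj: "lifts v (g \<otimes>\<^bsub>fund_group \<Lambda> x\<^esub> h \<otimes>\<^bsub>fund_group \<Lambda> x\<^esub> ?g) v"
    \<comment> \<open>The lift of the conjugate from \<open>v\<close> passes through
      \<open>u\<close> and \<open>c\<close> and ends at \<open>d\<close>. Uniqueness gives
      \<open>d = v\<close>, and then \<open>c = u\<close> since the inverse of \<open>g\<close>
      carries both to \<open>v\<close>.\<close>
    obtain c where c: "lifts u h c"
      using ex_lifts[of u h] lifts_closed[OF g(1)] h x by (auto simp: fund_group_iff)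
    have "po c = x" using lifts_closed[OF c] h by (simp add: fund_group_iff)
    then obtain d where d: "lifts c ?g d"
      using ex_lifts[of c ?g] lifts_closed[OF c] lifts_closed[OF inv] x by auto
    have "d = v" using conj lifts_mult[OF lifts_mult[OF g(1) c] d] lifts_unique by blast
    then have "c = u" using d inv lifts_left_unique by blast
    with c show "lifts u h u" by simp
  qed
qed

lemma stabilizer_subgroup:
  assumes v: "v \<in> Obj \<Omega>"
  shows "subgroup {g. lifts v g v} (fund_group \<Lambda> (po v))"
proof -
  interpret group "fund_group \<Lambda> (po v)" by (rule \<Lambda>.fund_group_group[OF po_closed[OF v]])
  have sub: "{g. lifts v g v} \<subseteq> carrier (fund_group \<Lambda> (po v))"
    using lifts_closed by (auto simp: fund_group_iff)
  show ?thesis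
  proof (rule subgroupI[OF sub])
    show "{g. lifts v g v} \<noteq> {}" using lifts_ident[OF v] by blast
    show "inv\<^bsub>fund_group \<Lambda> (po v)\<^esub> g \<in> {g. lifts v g v}" if "g \<in> {g. lifts v g v}" for g
      using that sub lifts_inv fund_group_inv[OF po_closed[OF v], of g] by auto
  qed (use lifts_mult in auto)
qed

section \<open>Orbits of the deck group and the induced map\<close>

lemma mem_obj_orbit_iff:
  "b \<in> obj_orbit \<Omega> p a \<longleftrightarrow> (\<exists>\<phi>\<in>carrier (Aut \<Omega> p). on_obj \<phi> a = b)"
  by (auto simp: orbit_def)

lemma mem_mor_orbit_iff:
  "\<beta> \<in> mor_orbit \<Omega> p \<alpha> \<longleftrightarrow> (\<exists>\<phi>\<in>carrier (Aut \<Omega> p). on_mor \<phi> \<alpha> = \<beta>)"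
  by (auto simp: orbit_def)

lemma one_Aut:
  "restrict_fmap fid \<in> carrier (Aut \<Omega> p)"
  using monoid.one_closed[OF group.is_monoid[OF Aut_group]] by (simp add: Aut_one)

lemma self_obj_orbit: "a \<in> Obj \<Omega> \<Longrightarrow> a \<in> obj_orbit \<Omega> p a"
  unfolding mem_obj_orbit_iff using one_Aut by (intro bexI[of _ "restrict_fmap fid"]) (simp_all add: fid_def)

lemma self_mor_orbit: "\<alpha> \<in> Mor \<Omega> \<Longrightarrow> \<alpha> \<in> mor_orbit \<Omega> p \<alpha>"
  unfolding mem_mor_orbit_iff using one_Aut by (intro bexI[of _ "restrict_fmap fid"]) (simp_all add: fid_def)

lemma induced_obj_orbit:
  assumes a: "a \<in> Obj \<Omega>"
  shows "on_obj (quotient_induced p) (obj_orbit \<Omega> p a) = po a"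
proof -
  have "the_elem (po ` obj_orbit \<Omega> p a) = po a"
  proof (rule the_elem_image_unique)
    show "obj_orbit \<Omega> p a \<noteq> {}" using self_obj_orbit[OF a] by blast
    show "po b = po a" if "b \<in> obj_orbit \<Omega> p a" for b
      using that deckD(2)[OF Aut_deck a] unfolding mem_obj_orbit_iff by blast
  qed
  then show ?thesis by (simp add: quotient_induced_def)
qed

lemma induced_mor_orbit:
  assumes \<alpha>: "\<alpha> \<in> Mor \<Omega>"
  shows "on_mor (quotient_induced p) (mor_orbit \<Omega> p \<alpha>) = pm \<alpha>"
proof -
  have "the_elem (pm ` mor_orbit \<Omega> p \<alpha>) = pm \<alpha>"
  proof (rule the_elem_image_unique)
    show "mor_orbit \<Omega> p \<alpha> \<noteq> {}" using self_mor_orbit[OF \<alpha>] by blast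
    show "pm \<beta> = pm \<alpha>" if "\<beta> \<in> mor_orbit \<Omega> p \<alpha>" for \<beta>
      using that deckD(4)[OF Aut_deck \<alpha>] unfolding mem_mor_orbit_iff by blast
  qed
  then show ?thesis by (simp add: quotient_induced_def)
qed

lemma quotient_Obj: "Obj (quotient_kgraph \<Omega> p) = obj_orbit \<Omega> p ` Obj \<Omega>"
  and quotient_Mor: "Mor (quotient_kgraph \<Omega> p) = mor_orbit \<Omega> p ` Mor \<Omega>"
  by (auto simp: quotient_kgraph_def orbits_def)

lemma induced_quotient_map: "feq_on \<Omega> (fcomp (quotient_induced p) (quotient_map \<Omega> p)) p"
  by (simp add: feq_on_def fcomp_def quotient_map_def induced_obj_orbit induced_mor_orbit)

text \<open>(iii) and (iv) differ only formally. The quotient map is onto, so a map out of the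
  quotient is determined by its composite with it; an inverse of the induced map therefore carries
  \<open>p\<close> to the quotient map.\<close>

lemma iso_iff_under_isomorphic:
  "kgraph_iso (quotient_kgraph \<Omega> p) \<Lambda> (quotient_induced p)
    \<longleftrightarrow> under_isomorphic \<Omega> \<Lambda> p (quotient_kgraph \<Omega> p) (quotient_map \<Omega> p)"
proof
  let ?Q = "quotient_kgraph \<Omega> p" and ?I = "quotient_induced p" and ?q = "quotient_map \<Omega> p"
  assume "kgraph_iso ?Q \<Lambda> ?I"
  then obtain G where I: "kgraph_morphism ?Q \<Lambda> ?I" and G: "kgraph_morphism \<Lambda> ?Q G"
    and inv: "feq_on ?Q (fcomp G ?I) fid" "feq_on \<Lambda> (fcomp ?I G) fid"
    by (auto simp: kgraph_iso_def)
  have "on_obj G (po a) = obj_orbit \<Omega> p a" if "a \<in> Obj \<Omega>" for a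
    using inv(1) that by (auto simp: feq_on_def fcomp_def fid_def quotient_Obj induced_obj_orbit)
  moreover have "on_mor G (pm \<alpha>) = mor_orbit \<Omega> p \<alpha>" if "\<alpha> \<in> Mor \<Omega>" for \<alpha>
    using inv(1) that by (auto simp: feq_on_def fcomp_def fid_def quotient_Mor induced_mor_orbit)
  ultimately have "feq_on \<Omega> (fcomp G p) ?q"
    by (simp add: feq_on_def fcomp_def quotient_map_def)
  then show "under_isomorphic \<Omega> \<Lambda> p ?Q ?q"
    using I G inv induced_quotient_map unfolding under_isomorphic_def under_morphism_def by blast
next
  let ?Q = "quotient_kgraph \<Omega> p" and ?I = "quotient_induced p" and ?q = "quotient_map \<Omega> p"
  assume "under_isomorphic \<Omega> \<Lambda> p ?Q ?q"
  then obtain \<phi> \<psi> where \<phi>: "kgraph_morphism \<Lambda> ?Q \<phi>" and \<psi>: "kgraph_morphism ?Q \<Lambda> \<psi>" "feq_on \<Omega> (fcomp \<psi> ?q) p"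
    and inv: "feq_on \<Lambda> (fcomp \<psi> \<phi>) fid" "feq_on ?Q (fcomp \<phi> \<psi>) fid"
    by (auto simp: under_isomorphic_def under_morphism_def)
  \<comment> \<open>Both maps send the orbit of an element to its image under \<open>p\<close>, and
    every element of the quotient is such an orbit.\<close>
  have eq: "feq_on ?Q \<psi> ?I"
    using \<psi>(2) induced_obj_orbit induced_mor_orbit
    by (auto simp: feq_on_def fcomp_def quotient_map_def quotient_Obj quotient_Mor)
  have "kgraph_morphism ?Q \<Lambda> ?I" by (rule kgraph_morphism_cong[OF \<psi>(1) eq])
  moreover have "feq_on ?Q (fcomp \<phi> ?I) fid"
    using eq inv(2) by (simp add: feq_on_def fcomp_def)
  moreover have "feq_on \<Lambda> (fcomp ?I \<phi>) fid"
  proof -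
    have "on_obj \<phi> y \<in> Obj ?Q" if "y \<in> Obj \<Lambda>" for y
      using \<phi> that by (simp add: kgraph_morphism_def is_functor_def)
    moreover have "on_mor \<phi> \<mu> \<in> Mor ?Q" if "\<mu> \<in> Mor \<Lambda>" for \<mu>
      using \<phi> that by (simp add: kgraph_morphism_def is_functor_def)
    ultimately show ?thesis using eq inv(1) by (simp add: feq_on_def fcomp_def)
  qed
  ultimately show "kgraph_iso ?Q \<Lambda> ?I" using \<phi> by (auto simp: kgraph_iso_def)
qed

end

text \<open>
  When the deck group is transitive on every fibre, the orbits are the fibres, so that the
  quotient is a copy of the base.
\<close>

locale transitive_kgraph_covering = kgraph_covering +
  assumes transitive: "\<lbrakk>a \<in> Obj \<Omega>; b \<in> Obj \<Omega>; po a = po b\<rbrakk> \<Longrightarrow> \<exists>\<phi>\<in>carrier (Aut \<Omega> p). on_obj \<phi> a = b"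
begin

abbreviation Q where "Q \<equiv> quotient_kgraph \<Omega> p"

text \<open>The two fibre maps index the quotient by \<Lambda>; they serve as the inverse of the
  induced map in \<open>induced_iso\<close>.\<close>

definition obj_fibre where "obj_fibre y = {a \<in> Obj \<Omega>. po a = y}"
definition mor_fibre where "mor_fibre \<mu> = {\<alpha> \<in> Mor \<Omega>. pm \<alpha> = \<mu>}"

lemma obj_orbit_eq:
  assumes a: "a \<in> Obj \<Omega>"
  shows "obj_orbit \<Omega> p a = obj_fibre (po a)"
proof (intro equalityI subsetI)
  show "b \<in> obj_fibre (po a)" if "b \<in> obj_orbit \<Omega> p a" for b
    using that deckD(1,2)[OF Aut_deck a] unfolding mem_obj_orbit_iff obj_fibre_def by blast
  show "b \<in> obj_orbit \<Omega> p a" if "b \<in> obj_fibre (po a)" for b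
    using that transitive[OF a] unfolding mem_obj_orbit_iff obj_fibre_def by simp
qed

text \<open>Transitivity is assumed on vertices only. For \<alpha> and \<beta> over the same
  morphism, a deck transformation matching their ranges carries \<alpha> to \<beta> by unique
  lifting.\<close>

lemma mor_orbit_eq:
  assumes \<alpha>: "\<alpha> \<in> Mor \<Omega>"
  shows "mor_orbit \<Omega> p \<alpha> = mor_fibre (pm \<alpha>)"
proof (intro equalityI subsetI)
  fix \<beta> assume "\<beta> \<in> mor_orbit \<Omega> p \<alpha>"
  then show "\<beta> \<in> mor_fibre (pm \<alpha>)"
    using deckD(3,4)[OF Aut_deck \<alpha>] unfolding mem_mor_orbit_iff mor_fibre_def by blast
next
  fix \<beta> assume "\<beta> \<in> mor_fibre (pm \<alpha>)"
  then have \<beta>: "\<beta> \<in> Mor \<Omega>" "pm \<alpha> = pm \<beta>" by (auto simp: mor_fibre_def)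
  then have "po (rng \<Omega> \<alpha>) = po (rng \<Omega> \<beta>)" using \<alpha> rng_pm by metis
  then obtain \<phi> where "\<phi> \<in> carrier (Aut \<Omega> p)" "on_obj \<phi> (rng \<Omega> \<alpha>) = rng \<Omega> \<beta>"
    using transitive[OF \<Omega>.rng_closed[OF \<alpha>] \<Omega>.rng_closed[OF \<beta>(1)]] by blast
  then show "\<beta> \<in> mor_orbit \<Omega> p \<alpha>"
    using deck_mor_eq[OF Aut_deck \<alpha> \<beta>(1) _ \<beta>(2)] unfolding mem_mor_orbit_iff by blast
qed

lemma Obj_Q: "Obj Q = obj_fibre ` Obj \<Lambda>"
  by (simp add: quotient_Obj obj_orbit_eq image_image flip: po_image)

lemma Mor_Q: "Mor Q = mor_fibre ` Mor \<Lambda>"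
  by (simp add: quotient_Mor mor_orbit_eq image_image flip: pm_image)

lemma obj_fibre_orbit: "y \<in> Obj \<Lambda> \<Longrightarrow> \<exists>a\<in>Obj \<Omega>. obj_fibre y = obj_orbit \<Omega> p a \<and> po a = y"
  using po_image obj_orbit_eq by (metis image_iff)

lemma mor_fibre_orbit: "\<mu> \<in> Mor \<Lambda> \<Longrightarrow> \<exists>\<alpha>\<in>Mor \<Omega>. mor_fibre \<mu> = mor_orbit \<Omega> p \<alpha> \<and> pm \<alpha> = \<mu>"
  using pm_image mor_orbit_eq by (metis image_iff)

lemma src_Q:
  assumes "\<mu> \<in> Mor \<Lambda>"
  shows "src Q (mor_fibre \<mu>) = obj_fibre (src \<Lambda> \<mu>)"
proof -
  obtain \<alpha> where "\<alpha> \<in> mor_fibre \<mu>" using mor_fibre_orbit[OF assms] by (auto simp: mor_fibre_def)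
  then have "the_elem {obj_orbit \<Omega> p (src \<Omega> \<alpha>) | \<alpha>. \<alpha> \<in> mor_fibre \<mu>} = obj_fibre (src \<Lambda> \<mu>)"
    by (rule the_elem_const) (auto simp: mor_fibre_def obj_orbit_eq \<Omega>.src_closed src_pm)
  then show ?thesis by (simp add: quotient_kgraph_def)
qed

lemma rng_Q:
  assumes "\<mu> \<in> Mor \<Lambda>"
  shows "rng Q (mor_fibre \<mu>) = obj_fibre (rng \<Lambda> \<mu>)"
proof -
  obtain \<alpha> where "\<alpha> \<in> mor_fibre \<mu>" using mor_fibre_orbit[OF assms] by (auto simp: mor_fibre_def)
  then have "the_elem {obj_orbit \<Omega> p (rng \<Omega> \<alpha>) | \<alpha>. \<alpha> \<in> mor_fibre \<mu>} = obj_fibre (rng \<Lambda> \<mu>)"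
    by (rule the_elem_const) (auto simp: mor_fibre_def obj_orbit_eq \<Omega>.rng_closed rng_pm)
  then show ?thesis by (simp add: quotient_kgraph_def)
qed

lemma deg_Q:
  assumes "\<mu> \<in> Mor \<Lambda>"
  shows "deg Q (mor_fibre \<mu>) = deg \<Lambda> \<mu>"
proof -
  obtain \<alpha> where "\<alpha> \<in> mor_fibre \<mu>" using mor_fibre_orbit[OF assms] by (auto simp: mor_fibre_def)
  then have "the_elem {deg \<Omega> \<alpha> | \<alpha>. \<alpha> \<in> mor_fibre \<mu>} = deg \<Lambda> \<mu>"
    by (rule the_elem_const) (auto simp: mor_fibre_def deg_pm)
  then show ?thesis by (simp add: quotient_kgraph_def)
qed

lemma ident_Q:
  assumes "y \<in> Obj \<Lambda>"
  shows "ident Q (obj_fibre y) = mor_fibre (ident \<Lambda> y)"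
proof -
  obtain a where "a \<in> obj_fibre y" using obj_fibre_orbit[OF assms] by (auto simp: obj_fibre_def)
  then have "the_elem {mor_orbit \<Omega> p (ident \<Omega> u) | u. u \<in> obj_fibre y} = mor_fibre (ident \<Lambda> y)"
    by (rule the_elem_const) (auto simp: obj_fibre_def mor_orbit_eq \<Omega>.ident_closed pm_ident)
  then show ?thesis by (simp add: quotient_kgraph_def)
qed

lemma comp_Q:
  assumes "\<mu> \<in> Mor \<Lambda>" "\<nu> \<in> Mor \<Lambda>" "src \<Lambda> \<mu> = rng \<Lambda> \<nu>"
  shows "mor_fibre \<mu> \<cdot>\<^bsub>Q\<^esub> mor_fibre \<nu> = mor_fibre (\<mu> \<cdot>\<^bsub>\<Lambda>\<^esub> \<nu>)"
proof -
  obtain \<alpha> where \<alpha>: "\<alpha> \<in> Mor \<Omega>" "pm \<alpha> = \<mu>" using mor_fibre_orbit assms by blast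
  have "rng \<Lambda> \<nu> = po (src \<Omega> \<alpha>)" using assms(3) \<alpha> src_pm[OF \<alpha>(1)] by simp
  \<comment> \<open>Composable representatives exist: \<nu> is lifted with range at the source of
    \<alpha>. Without such a pair the set under \<open>the_elem\<close> would be empty.\<close>
  then obtain \<beta> where \<beta>: "\<beta> \<in> Mor \<Omega>" "rng \<Omega> \<beta> = src \<Omega> \<alpha>" "pm \<beta> = \<nu>"
    using ex_lift_rng[OF \<Omega>.src_closed[OF \<alpha>(1)] assms(2)] by blast
  have orbit: "mor_orbit \<Omega> p (\<alpha> \<cdot>\<^bsub>\<Omega>\<^esub> \<beta>) = mor_fibre (\<mu> \<cdot>\<^bsub>\<Lambda>\<^esub> \<nu>)"
    if "\<alpha> \<in> mor_fibre \<mu>" "\<beta> \<in> mor_fibre \<nu>" "src \<Omega> \<alpha> = rng \<Omega> \<beta>" for \<alpha> \<beta>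
    using that mor_orbit_eq[OF \<Omega>.comp_closed] pm_comp by (simp add: mor_fibre_def[of \<mu>] mor_fibre_def[of \<nu>])
  have "\<alpha> \<in> mor_fibre \<mu>" "\<beta> \<in> mor_fibre \<nu>" using \<alpha> \<beta> by (simp_all add: mor_fibre_def)
  then have "{mor_orbit \<Omega> p (\<alpha> \<cdot>\<^bsub>\<Omega>\<^esub> \<beta>) | \<alpha> \<beta>. \<alpha> \<in> mor_fibre \<mu> \<and> \<beta> \<in> mor_fibre \<nu> \<and> src \<Omega> \<alpha> = rng \<Omega> \<beta>}
      = {mor_fibre (\<mu> \<cdot>\<^bsub>\<Lambda>\<^esub> \<nu>)}"
    using orbit \<beta>(2)[symmetric] by blast
  then show ?thesis by (simp add: quotient_kgraph_def)
qed

lemma induced_obj_fibre: "y \<in> Obj \<Lambda> \<Longrightarrow> on_obj (quotient_induced p) (obj_fibre y) = y"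
  using obj_fibre_orbit induced_obj_orbit by metis

lemma obj_fibre_eq_iff: "y \<in> Obj \<Lambda> \<Longrightarrow> z \<in> Obj \<Lambda> \<Longrightarrow> obj_fibre y = obj_fibre z \<longleftrightarrow> y = z"
  using induced_obj_fibre by metis

text \<open>All operations of \<open>Q\<close> have been computed on fibres, and distinct vertices
  of \<Lambda> have distinct fibres, so composability and the category laws are inherited from
  \<Lambda>.\<close>

lemma category_Q: "category Q"
  by unfold_locales
    (auto simp: Obj_Q Mor_Q src_Q rng_Q ident_Q comp_Q obj_fibre_eq_iff
      \<Lambda>.src_closed \<Lambda>.rng_closed \<Lambda>.ident_closed \<Lambda>.comp_closed \<Lambda>.src_ident \<Lambda>.rng_ident
      \<Lambda>.src_comp \<Lambda>.rng_comp \<Lambda>.comp_assoc \<Lambda>.comp_ident_left \<Lambda>.comp_ident_right)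

lemma induced_mor_fibre: "\<mu> \<in> Mor \<Lambda> \<Longrightarrow> on_mor (quotient_induced p) (mor_fibre \<mu>) = \<mu>"
  using mor_fibre_orbit induced_mor_orbit by metis

lemma induced_iso: "kgraph_iso Q \<Lambda> (quotient_induced p)"
proof -
  define G where "G = \<lparr>on_obj = obj_fibre, on_mor = mor_fibre\<rparr>"
  note closed = \<Lambda>.src_closed \<Lambda>.rng_closed \<Lambda>.ident_closed \<Lambda>.comp_closed
  have "kgraph_morphism Q \<Lambda> (quotient_induced p)"
    by (auto simp: kgraph_morphism_def is_functor_def category_Q \<Lambda>.category_axioms Obj_Q Mor_Q
        src_Q rng_Q ident_Q comp_Q deg_Q obj_fibre_eq_iff closed induced_obj_fibre induced_mor_fibre)
  moreover have "kgraph_morphism \<Lambda> Q G"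
    by (auto simp: G_def kgraph_morphism_def is_functor_def category_Q \<Lambda>.category_axioms Obj_Q Mor_Q
        src_Q rng_Q ident_Q comp_Q deg_Q)
  moreover have "feq_on Q (fcomp G (quotient_induced p)) fid" "feq_on \<Lambda> (fcomp (quotient_induced p) G) fid"
    by (auto simp: G_def feq_on_def fcomp_def fid_def Obj_Q Mor_Q induced_obj_fibre induced_mor_fibre)
  ultimately show ?thesis unfolding kgraph_iso_def by blast
qed

end

section \<open>Normality, transitivity and triviality of the quotient covering\<close>

context connected_kgraph_covering
begin

text \<open>Forward, normality makes all stabilizers over the base vertex equal, so
  \<open>ex_Aut\<close> applies. Backward, if \<open>g\<close> carries \<open>v\<close> to
  \<open>u\<close>, a deck transformation with the same effect on \<open>v\<close> shows that the
  stabilizer of \<open>v\<close> fixes \<open>u\<close>, and \<open>lifts_conjugate\<close>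
  concludes.\<close>

lemma normal_iff_transitive:
  assumes v: "v \<in> Obj \<Omega>"
  shows "normal {g. lifts v g v} (fund_group \<Lambda> (po v)) \<longleftrightarrow>
    (\<forall>a\<in>vertex_fibre \<Omega> p (po v). \<forall>b\<in>vertex_fibre \<Omega> p (po v). \<exists>\<phi>\<in>carrier (Aut \<Omega> p). on_obj \<phi> a = b)"
    (is "normal ?H ?G \<longleftrightarrow> ?T")
proof
  interpret group ?G by (rule \<Lambda>.fund_group_group[OF po_closed[OF v]])
  assume "normal ?H ?G"
  then interpret normal ?H ?G .
  have stab: "lifts u h u \<longleftrightarrow> lifts v h v" if u: "u \<in> vertex_fibre \<Omega> p (po v)" for u h
  proof (cases "h \<in> carrier ?G")
    case h: True
    obtain g where g: "lifts v g u" using ex_lifts_between v u by (auto simp: vertex_fibre_def)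
    have gG: "g \<in> carrier ?G" using lifts_closed[OF g] u by (simp add: fund_group_iff vertex_fibre_def)
    let ?c = "g \<otimes>\<^bsub>?G\<^esub> h \<otimes>\<^bsub>?G\<^esub> inv\<^bsub>?G\<^esub> g"
    \<comment> \<open>Recovering \<open>h\<close> from its conjugate lets normality be used for both
      implications.\<close>
    have "inv\<^bsub>?G\<^esub> g \<otimes>\<^bsub>?G\<^esub> ?c \<otimes>\<^bsub>?G\<^esub> g = h" using h gG by (simp add: m_assoc) (simp flip: m_assoc)
    then have "?c \<in> ?H \<longleftrightarrow> h \<in> ?H" using inv_op_closed1[OF gG, of ?c] inv_op_closed2[OF gG, of h] by auto
    then show ?thesis using lifts_conjugate[OF g gG h] by simp
  next
    \<comment> \<open>A class that fixes a vertex over the base vertex is a loop there, so outside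
      the fundamental group both sides are false.\<close>
    case False
    then show ?thesis using u lifts_closed(3-5) by (auto simp: fund_group_iff vertex_fibre_def)
  qed
  show ?T
    using ex_Aut stab by (simp add: vertex_fibre_def)
next
  interpret group ?G by (rule \<Lambda>.fund_group_group[OF po_closed[OF v]])
  assume T: ?T
  show "normal ?H ?G"
    unfolding normal_inv_iff
  proof (intro conjI ballI)
    show "subgroup ?H ?G" by (rule stabilizer_subgroup[OF v])
    fix g h assume g: "g \<in> carrier ?G" and "h \<in> ?H"
    then have h: "lifts v h v" "h \<in> carrier ?G"
      using lifts_closed[of v h v] by (auto simp: fund_group_iff)
    obtain u where u: "lifts v g u" using ex_lifts[OF v] g by (auto simp: fund_group_iff)
    then have "u \<in> vertex_fibre \<Omega> p (po v)"
      using lifts_closed[OF u] g by (simp add: vertex_fibre_def fund_group_iff)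
    then obtain \<phi> where "\<phi> \<in> carrier (Aut \<Omega> p)" "on_obj \<phi> v = u"
      using T v by (auto simp: vertex_fibre_def)
    then have "lifts u h u" using deck_lifts[OF Aut_deck h(1)] by blast
    then show "g \<otimes>\<^bsub>?G\<^esub> h \<otimes>\<^bsub>?G\<^esub> inv\<^bsub>?G\<^esub> g \<in> ?H" using lifts_conjugate[OF u g h(2)] by simp
  qed
qed

text \<open>Forward, transitivity is transported from one fibre to all others along lifts. Backward,
  a left inverse of the induced map forces vertices with equal image into one orbit.\<close>

lemma transitive_iff_iso:
  assumes v: "v \<in> Obj \<Omega>"
  shows "(\<forall>a\<in>vertex_fibre \<Omega> p (po v). \<forall>b\<in>vertex_fibre \<Omega> p (po v). \<exists>\<phi>\<in>carrier (Aut \<Omega> p). on_obj \<phi> a = b)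
    \<longleftrightarrow> kgraph_iso (quotient_kgraph \<Omega> p) \<Lambda> (quotient_induced p)" (is "?T \<longleftrightarrow> ?I")
proof
  assume T: ?T
  interpret transitive_kgraph_covering k \<Omega> \<Lambda> p
  proof
    fix a b assume a: "a \<in> Obj \<Omega>" and b: "b \<in> Obj \<Omega>" and ab: "po a = po b"
    obtain g where g: "lifts a g v" using ex_lifts_between a v by blast
    then obtain c where c: "lifts b g c" using ex_lifts[OF b lifts_closed(3)[OF g]] lifts_closed(4)[OF g] ab by auto
    then have "c \<in> vertex_fibre \<Omega> p (po v)"
      using lifts_closed[OF c] lifts_closed[OF g] by (simp add: vertex_fibre_def)
    then obtain \<phi> where \<phi>: "\<phi> \<in> carrier (Aut \<Omega> p)" "on_obj \<phi> v = c"
      using T v by (auto simp: vertex_fibre_def)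
    \<comment> \<open>Equivariance carries the image of \<open>a\<close> along \<open>g\<close> to
      \<open>c\<close>, where the lift of \<open>g\<close> from \<open>b\<close> also ends; a lift
      is determined by its source.\<close>
    then have "on_obj \<phi> a = b"
      using deck_lifts[OF Aut_deck g] c lifts_left_unique by blast
    with \<phi> show "\<exists>\<phi>\<in>carrier (Aut \<Omega> p). on_obj \<phi> a = b" by blast
  qed
  show ?I by (rule induced_iso)
next
  assume ?I
  then obtain G where "feq_on (quotient_kgraph \<Omega> p) (fcomp G (quotient_induced p)) fid"
    by (auto simp: kgraph_iso_def)
  then have "on_obj G (po a) = obj_orbit \<Omega> p a" if "a \<in> Obj \<Omega>" for a
    using that by (auto simp: feq_on_def fcomp_def fid_def quotient_Obj induced_obj_orbit)
  then have orbit: "obj_orbit \<Omega> p a = obj_orbit \<Omega> p b" if "a \<in> Obj \<Omega>" "b \<in> Obj \<Omega>" "po a = po b" for a b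
    using that by metis
  show ?T
  proof (intro ballI)
    fix a b assume "a \<in> vertex_fibre \<Omega> p (po v)" "b \<in> vertex_fibre \<Omega> p (po v)"
    then have "b \<in> obj_orbit \<Omega> p a"
      using self_obj_orbit[of b] orbit[of a b] by (simp add: vertex_fibre_def)
    then show "\<exists>\<phi>\<in>carrier (Aut \<Omega> p). on_obj \<phi> a = b" by (simp only: mem_obj_orbit_iff)
  qed
qed

end

theorem corollary2p4:
  fixes k :: nat
    and \<Omega> :: "('o1, 'm1) kgraph"
    and \<Lambda> :: "('o2, 'm2) kgraph"
    and p :: "('o1, 'm1, 'o2, 'm2) fmap"
    and x :: 'o2 and v :: 'o1
  assumes "connected_covering k \<Omega> \<Lambda> p"
    and "x \<in> Obj \<Lambda>"
    and "v \<in> vertex_fibre \<Omega> p x"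
  shows "(normal (induced_map \<Lambda> p ` carrier (fund_group \<Omega> v)) (fund_group \<Lambda> x)
          \<longleftrightarrow> transitive_action (Aut \<Omega> p) (vertex_fibre \<Omega> p x)
                (\<lambda>\<phi>. restrict (on_obj \<phi>) (vertex_fibre \<Omega> p x)))
       \<and> (transitive_action (Aut \<Omega> p) (vertex_fibre \<Omega> p x)
                (\<lambda>\<phi>. restrict (on_obj \<phi>) (vertex_fibre \<Omega> p x))
          \<longleftrightarrow> kgraph_iso (quotient_kgraph \<Omega> p) \<Lambda> (quotient_induced p))
       \<and> (kgraph_iso (quotient_kgraph \<Omega> p) \<Lambda> (quotient_induced p)
          \<longleftrightarrow> under_isomorphic \<Omega> \<Lambda> p (quotient_kgraph \<Omega> p) (quotient_map \<Omega> p))"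
proof -
  interpret connected_kgraph_covering k \<Omega> \<Lambda> p
    using assms(1) by unfold_locales (simp_all add: connected_covering_def)
  have v: "v \<in> Obj \<Omega>" and x: "x = on_obj p v" using assms(3) by (auto simp: vertex_fibre_def)
  show ?thesis
    unfolding transitive_iff image_fund_group[OF v]
    unfolding x normal_iff_transitive[OF v] transitive_iff_iso[OF v] iso_iff_under_isomorphic
    by blast
qed

end
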